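(* Let $M,c>0$ and let $a\in\mathrm{Lip}(\mathbb{R}^+,\mathbb{R}^+)$, which implies that $\lim_{s\to0}s\,a(s)=0$. Let $\mu$ be the solution of $$\partial_t\mu+\mathrm{div}\big((\xi[\mu]+\chi_\omega u)\mu\big)=0,\qquad\xi[\mu](x)=\int_{\mathbb{R}^d}a(\|x-y\|)(y-x)\,d\mu(y),$$ with the control $\chi_\omega u$ given by $$\omega(t):=\arg\max_{\omega\in\Omega_c}\int_\omega\|x-\bar x(t)\|\,d\mu(t)(x),\qquad u(x,t)=M\frac{x-\bar x(t)}{\|x-\bar x(t)\|}\ \text{ for all }x\in\omega(t)\setminus\{\bar x(t)\}.$$ Let $X(t)=\inf\{X\geq0:\ \mathrm{supp}(\mu(t))\subseteq B(\bar x(t),X)\}$ be the size of the support of $\mu(t)$. Then there exist $\eta>0$ and $\tau>0$ such that for all $t\geq\tau$, $X(t)\geq\eta$.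
   Context: $\mu(t)=\mu(t,\cdot)$ is a compactly supported probability measure on $\mathbb{R}^d$ for every $t$; $\bar x(t)=\int_{\mathbb{R}^d}x\,d\mu(t)(x)$ is its center of mass. $\Omega_c=\{\omega\subset\mathbb{R}^d:|\omega|\leq c\}$ with $|\cdot|$ Lebesgue measure; $\chi_\omega$ is the indicator function of $\omega$; $B(x,r)$ is the ball of center $x$ and radius $r$. $\mathrm{Lip}(\mathbb{R}^+,\mathbb{R}^+)$ is the set of Lipschitz functions from $\mathbb{R}^+=[0,\infty)$ to itself. The controls are subject to the constraints $\|u(t,\cdot)\|_{L^\infty(\mathbb{R}^d)}\leq M$ and $\omega(t)\in\Omega_c$.
   Formalization: Assumes μ(0) is not a Dirac mass: otherwise μ(t)=δ_{x0} with u=0 at the center of mass satisfies everything and X(t)=0. The bound ‖u‖≤M is also required μ(t)-almost everywhere, which is automatic if μ(t) is absolutely continuous. *)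

theory Defs
  imports "HOL-Probability.Probability"
begin

definition measure_support :: "'a::topological_space measure \<Rightarrow> 'a set" where
  "measure_support \<mu> = {x. \<forall>U. open U \<longrightarrow> x \<in> U \<longrightarrow> emeasure \<mu> U > 0}"

definition compactly_supported_prob :: "'a::topological_space measure \<Rightarrow> bool" where
  "compactly_supported_prob \<mu> \<longleftrightarrow>
     prob_space \<mu> \<and> sets \<mu> = sets borel \<and> compact (measure_support \<mu>)"

definition center_of_mass :: "'a::euclidean_space measure \<Rightarrow> 'a" where
  "center_of_mass \<mu> = (\<integral>x. x \<partial>\<mu>)"

definition support_size :: "'a::euclidean_space measure \<Rightarrow> real" where
  "support_size \<mu> = Inf {X. 0 \<le> X \<and> measure_support \<mu> \<subseteq> ball (center_of_mass \<mu>) X}"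

definition interaction_field :: "(real \<Rightarrow> real) \<Rightarrow> 'a::euclidean_space measure \<Rightarrow> 'a \<Rightarrow> 'a" where
  "interaction_field a \<mu> x = (\<integral>y. a (norm (x - y)) *\<^sub>R (y - x) \<partial>\<mu>)"

(* Control sets are Borel because they are integrated over against arbitrary Borel measures.
   The bound uses emeasure: the real-valued measure would give 0 to sets of infinite volume. *)
definition control_sets :: "real \<Rightarrow> 'a::euclidean_space set set" where
  "control_sets c = {\<omega> \<in> sets borel. emeasure lborel \<omega> \<le> ennreal c}"

(* Test functions: phi of class C^1 with compact support, together with its gradient. *)
definition test_function :: "('a::euclidean_space \<Rightarrow> real) \<Rightarrow> ('a \<Rightarrow> 'a) \<Rightarrow> bool" where
  "test_function \<phi> \<phi>' \<longleftrightarrow>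
     (\<forall>x. GDERIV \<phi> x :> \<phi>' x) \<and> continuous_on UNIV \<phi>' \<and> compact (closure {x. \<phi> x \<noteq> 0})"

(* Weak (distributional) solutions on [0,\<infinity>) of d/dt \<mu> + div (v \<mu>) = 0, written in
   time-integrated form; the formulation implies that \<mu> is continuous in time.
   Since v is integrable, testing with C^1 or with smooth functions of compact
   support is the same. *)
definition continuity_equation ::
  "(real \<Rightarrow> 'a::euclidean_space measure) \<Rightarrow> (real \<Rightarrow> 'a \<Rightarrow> 'a) \<Rightarrow> bool" where
  "continuity_equation \<mu> v \<longleftrightarrow>
     (AE t in lborel. 0 \<le> t \<longrightarrow> integrable (\<mu> t) (v t)) \<and>
     (\<forall>T\<ge>0. set_integrable lborel {0..T} (\<lambda>t. \<integral>x. norm (v t x) \<partial>\<mu> t)) \<and>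
     (\<forall>\<phi> \<phi>' t. test_function \<phi> \<phi>' \<longrightarrow> 0 \<le> t \<longrightarrow>
        set_integrable lborel {0..t} (\<lambda>s. \<integral>x. \<phi>' x \<bullet> v s x \<partial>\<mu> s) \<and>
        (\<integral>x. \<phi> x \<partial>\<mu> t) =
          (\<integral>x. \<phi> x \<partial>\<mu> 0) + (LINT s:{0..t}|lborel. (\<integral>x. \<phi>' x \<bullet> v s x \<partial>\<mu> s)))"

(* The L^\<infinity> constraint. Lebesgue-a.e. bounds say nothing on the singular part of \<mu>, where the
   velocity matters as well, so the bound is also required \<mu>-a.e.; the second requirement
   is void when \<mu> is absolutely continuous. *)
definition control_bounded_by ::
  "real \<Rightarrow> 'a::euclidean_space measure \<Rightarrow> ('a \<Rightarrow> 'a) \<Rightarrow> bool" where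
  "control_bounded_by M \<mu> u \<longleftrightarrow>
     u \<in> borel_measurable borel \<and> (AE x in lborel. norm (u x) \<le> M) \<and> (AE x in \<mu>. norm (u x) \<le> M)"

(* is_arg_max: maximizers need not be unique, and \<omega> may be any of them. *)
definition spreading_control ::
  "real \<Rightarrow> real \<Rightarrow> 'a::euclidean_space measure \<Rightarrow> 'a set \<Rightarrow> ('a \<Rightarrow> 'a) \<Rightarrow> bool" where
  "spreading_control M c \<mu> \<omega> u \<longleftrightarrow>
     is_arg_max (\<lambda>\<omega>. LINT x:\<omega>|\<mu>. norm (x - center_of_mass \<mu>)) (\<lambda>\<omega>. \<omega> \<in> control_sets c) \<omega> \<and>
     control_bounded_by M \<mu> u \<and>
     (\<forall>x \<in> \<omega> - {center_of_mass \<mu>}.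
        u x = (M / norm (x - center_of_mass \<mu>)) *\<^sub>R (x - center_of_mass \<mu>))"

end

theory Submission
  imports Defs "HOL-Real_Asymp.Real_Asymp"
begin

text \<open>
  For a vector e let h(e) be the supremum of e.x over the support of the measure; then
  w(e) = h(e) + h(-e) is the width of the support in direction e. When the support is small, a ball
  around the centre of mass is admissible and captures everything, so every maximiser contains
  almost all of the mass away from the centre, and the control pushes with speed M radially. At a point
  realising h(e) the control then contributes at least M/X (h(e) - e.m), with m the centre of mass,
  and the interaction at least -A w(e), where A bounds the kernel on the scale 2X. Adding the opposite
  direction removes m, so that w(e)' is at least (M/X - 2A) w(e). Hence the total width W of the
  support over an orthonormal basis grows while it is below some threshold; since W depends continuously on time,
  it must reach the threshold and can never go below it again. The size X lies between
  W/(2d) and W.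

  No characteristics are needed for weak solutions: h(e) is the limit of (1/n) ln of
  the integral of exp(n e.x), whose time derivative is the average of e.v under a tilted measure that
  concentrates where e.x is close to h(e). Unbounded supports in finite time are excluded with
  convex test functions of e.x, for which the attraction term is nonpositive by symmetry.
\<close>

subsection \<open>Support and extent of a compactly supported measure\<close>

text \<open>The velocity is discontinuous: control sets are merely Borel and the radial direction
  jumps at the centre of mass. No flow map is at hand, so the width has to be read off from
  integrals against \<mu>(t). Two obstacles shape this. The weak equation only admits test functions
  of compact support, whereas exp(n e.x) is not even Lipschitz; and the support is known to be
  compact at each time separately, without a bound uniform on time intervals. Exponentials are
  therefore continued by a tangent line until finite speed of the support is available. Attraction
  and control must be compared within one direction. The attraction along e is bounded by the width
  in that same direction, not by the diameter, so a thin direction also grows. The rate is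
  proportional to the width itself, hence growth can only start if some width is positive; this is
  where an initial Dirac mass has to be excluded.\<close>

lemma closed_measure_support: "closed (measure_support \<mu>)"
proof -
  have "- measure_support \<mu> = \<Union>{U. open U \<and> emeasure \<mu> U = 0}"
    unfolding measure_support_def by (auto simp: zero_less_iff_neq_zero)
  then show ?thesis
    unfolding closed_def by auto
qed

text \<open>By second countability the complement of the support is covered by countably many basic
  open sets of measure zero.\<close>

lemma AE_measure_support:
  fixes \<mu> :: "'a::second_countable_topology measure"
  assumes "sets \<mu> = sets borel"
  shows "AE x in \<mu>. x \<in> measure_support \<mu>"
proof -
  obtain B :: "'a set set" where B: "countable B" "topological_basis B"
    using ex_countable_basis by blast
  define N where "N = {b \<in> B. emeasure \<mu> b = 0}"
  have N: "\<Union>N \<in> null_sets \<mu>"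
  proof -
    have "countable N"
      unfolding N_def using B(1) by auto
    moreover have "b \<in> null_sets \<mu>" if "b \<in> N" for b
      using that assms topological_basis_open[OF B(2)] by (auto simp: N_def null_sets_def)
    ultimately show ?thesis
      using null_sets_UN'[of N "\<lambda>b. b" \<mu>] by simp
  qed
  have "x \<in> \<Union>N" if "x \<notin> measure_support \<mu>" for x
  proof -
    from that obtain U where U: "open U" "x \<in> U" "emeasure \<mu> U = 0"
      by (auto simp: measure_support_def zero_less_iff_neq_zero)
    then obtain b where b: "b \<in> B" "x \<in> b" "b \<subseteq> U"
      using B(2) topological_basisE by metis
    have "emeasure \<mu> b \<le> emeasure \<mu> U"
      using b U assms by (intro emeasure_mono) auto
    then show ?thesis
      using U(3) b by (auto simp: N_def)
  qed
  then show ?thesis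
    by (intro AE_I'[OF N]) auto
qed

locale compact_prob = prob_space \<mu> for \<mu> :: "'a::euclidean_space measure" +
  assumes sets_eq [measurable_cong]: "sets \<mu> = sets borel"
    and compact_support: "compact (measure_support \<mu>)"

lemma compact_prob_iff: "compactly_supported_prob \<mu> \<longleftrightarrow> compact_prob \<mu>"
  by (simp add: compactly_supported_prob_def compact_prob_def compact_prob_axioms_def)

text \<open>The support function of the support. Together with \<open>extent \<mu> (- e)\<close> it
  gives the width across direction \<open>e\<close>, which is invariant under translations.\<close>

definition extent :: "'a::euclidean_space measure \<Rightarrow> 'a \<Rightarrow> real" where
  "extent \<mu> e = (SUP x\<in>measure_support \<mu>. e \<bullet> x)"

context compact_prob
begin

lemma space_eq: "space \<mu> = UNIV"
  using sets_eq_imp_space_eq[OF sets_eq] by simp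

lemma AE_support: "AE x in \<mu>. x \<in> measure_support \<mu>"
  by (rule AE_measure_support[OF sets_eq])

lemma support_nonempty: "measure_support \<mu> \<noteq> {}"
proof
  assume "measure_support \<mu> = {}"
  with AE_support have "AE x in \<mu>. False" by simp
  then show False by simp
qed

lemma norm_support_bound:
  obtains R where "R \<ge> 0" "\<And>x. x \<in> measure_support \<mu> \<Longrightarrow> norm x \<le> R"
proof -
  obtain R where R: "\<forall>x\<in>measure_support \<mu>. norm x \<le> R"
    using compact_imp_bounded[OF compact_support] bounded_iff by metis
  show ?thesis
    using R by (intro that[of "max 0 R"]) (auto intro: max.coboundedI2)
qed

lemma integrable_on_support:
  fixes f :: "'a \<Rightarrow> 'b::{banach,second_countable_topology}"
  assumes "f \<in> borel_measurable borel" "AE x in \<mu>. x \<in> measure_support \<mu> \<longrightarrow> norm (f x) \<le> C"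
  shows "integrable \<mu> f"
proof (rule integrable_const_bound)
  show "AE x in \<mu>. norm (f x) \<le> C"
    using AE_support assms(2) by eventually_elim auto
qed (use assms(1) in measurable)

lemma integrable_continuous:
  fixes f :: "'a \<Rightarrow> 'b::{banach,second_countable_topology}"
  assumes "continuous_on UNIV f"
  shows "integrable \<mu> f"
proof -
  have "compact (f ` measure_support \<mu>)"
    using assms compact_support by (meson compact_continuous_image continuous_on_subset subset_UNIV)
  then obtain C where "\<forall>x\<in>measure_support \<mu>. norm (f x) \<le> C"
    using compact_imp_bounded bounded_iff by (metis (no_types, lifting) image_eqI)
  then show ?thesis
    using assms by (intro integrable_on_support[of f C]) (auto intro: borel_measurable_continuous_onI)
qed

lemma bdd_above_extent: "bdd_above ((\<lambda>x. e \<bullet> x) ` measure_support \<mu>)"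
proof -
  have "compact ((\<lambda>x. e \<bullet> x) ` measure_support \<mu>)"
    by (intro compact_continuous_image compact_support continuous_intros)
  then show ?thesis
    by (simp add: bounded_imp_bdd_above compact_imp_bounded)
qed

lemma extent_upper: "x \<in> measure_support \<mu> \<Longrightarrow> e \<bullet> x \<le> extent \<mu> e"
  unfolding extent_def by (intro cSUP_upper bdd_above_extent)

lemma extent_least: "(\<And>x. x \<in> measure_support \<mu> \<Longrightarrow> e \<bullet> x \<le> k) \<Longrightarrow> extent \<mu> e \<le> k"
  unfolding extent_def by (intro cSUP_least support_nonempty)

lemma AE_extent: "AE x in \<mu>. e \<bullet> x \<le> extent \<mu> e"
  using AE_support by eventually_elim (rule extent_upper)

lemma extent_lower: "x \<in> measure_support \<mu> \<Longrightarrow> - extent \<mu> (- e) \<le> e \<bullet> x"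
  using extent_upper[of x "- e"] by simp

text \<open>An open half-space that meets the support has positive mass, so the supremum over the
  support is also the essential supremum of e.x. Exponential moments can therefore detect
  it.\<close>

lemma prob_above:
  assumes "k < extent \<mu> e"
  shows "prob {x. k < e \<bullet> x} > 0"
proof -
  obtain x where x: "x \<in> measure_support \<mu>" "k < e \<bullet> x"
    using assms extent_least[of e k] by (meson not_le)
  have "open {x. k < e \<bullet> x}"
    by (intro open_Collect_less continuous_intros)
  with x have "emeasure \<mu> {x. k < e \<bullet> x} > 0"
    unfolding measure_support_def by blast
  then show ?thesis
    by (simp add: emeasure_eq_measure)
qed

lemma integrable_ident: "integrable \<mu> (\<lambda>x. x)"
  by (intro integrable_continuous continuous_intros)

lemma inner_center_of_mass: "e \<bullet> center_of_mass \<mu> = (\<integral>x. e \<bullet> x \<partial>\<mu>)"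
  unfolding center_of_mass_def using integrable_ident by simp

lemma center_le_extent: "e \<bullet> center_of_mass \<mu> \<le> extent \<mu> e"
proof -
  have "(\<integral>x. e \<bullet> x \<partial>\<mu>) \<le> (\<integral>x. extent \<mu> e \<partial>\<mu>)"
    by (intro integral_mono_AE AE_extent integrable_continuous continuous_intros)
  then show ?thesis
    by (simp add: inner_center_of_mass prob_space)
qed

lemma center_ge_extent: "- extent \<mu> (- e) \<le> e \<bullet> center_of_mass \<mu>"
  using center_le_extent[of "- e"] by simp

text \<open>If the mean of e.x reached its upper bound, e.x would equal that bound almost
  everywhere; positive width puts mass strictly below it.\<close>

lemma center_less_extent:
  assumes "extent \<mu> e + extent \<mu> (- e) > 0"
  shows "e \<bullet> center_of_mass \<mu> < extent \<mu> e"
proof (rule ccontr)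
  assume "\<not> ?thesis"
  then have eq: "e \<bullet> center_of_mass \<mu> = extent \<mu> e"
    using center_le_extent[of e] by simp
  have int: "integrable \<mu> (\<lambda>x. extent \<mu> e - e \<bullet> x)"
    by (intro integrable_continuous continuous_intros)
  have "(\<integral>x. extent \<mu> e - e \<bullet> x \<partial>\<mu>) = 0"
    using eq by (subst Bochner_Integration.integral_diff)
      (auto intro!: integrable_continuous continuous_intros simp: inner_center_of_mass prob_space)
  then have "AE x in \<mu>. extent \<mu> e - e \<bullet> x = 0"
    using AE_extent[of e] integral_nonneg_eq_0_iff_AE[OF int] by auto
  \<comment> \<open>The half-space e.x < \<open>extent \<mu> e\<close>, written for the direction
    \<open>- e\<close> so that \<open>prob_above\<close> applies; positive width is exactly the
    required inequality \<open>- extent \<mu> e < extent \<mu> (- e)\<close>.\<close>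
  then have "AE x in \<mu>. x \<notin> {x. - extent \<mu> e < - e \<bullet> x}"
    by eventually_elim auto
  moreover have "{x. - extent \<mu> e < - e \<bullet> x} \<in> sets \<mu>"
    unfolding sets_eq by (intro borel_open open_Collect_less continuous_intros)
  ultimately have "prob {x. - extent \<mu> e < - e \<bullet> x} = 0"
    by (subst prob_eq_0) auto
  moreover have "prob {x. - extent \<mu> e < - e \<bullet> x} > 0"
    using assms by (intro prob_above) auto
  ultimately show False by linarith
qed

text \<open>In each basis direction the point and the centre of mass lie between the same two
  hyperplanes, so their coordinates differ by at most the width; the l1 norm dominates the Euclidean
  one. A free bound \<open>r\<close> allows total width zero to be fed in.\<close>

lemma norm_diff_center_le:
  assumes "(\<Sum>e\<in>Basis. extent \<mu> e + extent \<mu> (- e)) \<le> r" "x \<in> measure_support \<mu>"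
  shows "norm (x - center_of_mass \<mu>) \<le> r"
proof -
  have "norm (x - center_of_mass \<mu>) \<le> (\<Sum>e\<in>Basis. \<bar>(x - center_of_mass \<mu>) \<bullet> e\<bar>)"
    by (rule norm_le_l1)
  also have "\<dots> \<le> (\<Sum>e\<in>Basis. extent \<mu> e + extent \<mu> (- e))"
  proof (rule sum_mono)
    fix e :: 'a
    show "\<bar>(x - center_of_mass \<mu>) \<bullet> e\<bar> \<le> extent \<mu> e + extent \<mu> (- e)"
      using extent_upper[OF assms(2), of e] extent_lower[OF assms(2), of e]
        center_le_extent[of e] center_ge_extent[of e]
      by (simp add: inner_diff_right inner_commute[of _ e])
  qed
  finally show ?thesis using assms(1) by simp
qed

text \<open>A ball of radius X has width 2X in each of the d basis directions; this is the origin of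
  the factor 2d.\<close>

lemma width_le_support_size:
  "(\<Sum>e\<in>Basis. extent \<mu> e + extent \<mu> (- e)) \<le> 2 * DIM('a) * support_size \<mu>"
proof -
  define W where "W = (\<Sum>e\<in>Basis. extent \<mu> e + extent \<mu> (- e))"
  obtain R where R: "R \<ge> 0" "\<And>x. x \<in> measure_support \<mu> \<Longrightarrow> norm x \<le> R"
    using norm_support_bound by blast
  have "W / (2 * DIM('a)) \<le> support_size \<mu>"
    unfolding support_size_def
  proof (rule cInf_greatest)
    \<comment> \<open>A lower bound for all admissible radii passes to their infimum only if there
      is one; boundedness of the support supplies it, with 1 added because the ball is open.\<close>
    have "measure_support \<mu> \<subseteq> ball (center_of_mass \<mu>) (R + norm (center_of_mass \<mu>) + 1)"
    proof
      fix x assume "x \<in> measure_support \<mu>"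
      then have "norm x \<le> R" by (rule R)
      then show "x \<in> ball (center_of_mass \<mu>) (R + norm (center_of_mass \<mu>) + 1)"
        using norm_triangle_ineq4[of "center_of_mass \<mu>" x] by (simp add: dist_norm)
    qed
    moreover have "0 \<le> R + norm (center_of_mass \<mu>) + 1" using R by simp
    ultimately show "{X. 0 \<le> X \<and> measure_support \<mu> \<subseteq> ball (center_of_mass \<mu>) X} \<noteq> {}"
      by blast
  next
    fix X assume X: "X \<in> {X. 0 \<le> X \<and> measure_support \<mu> \<subseteq> ball (center_of_mass \<mu>) X}"
    have "W \<le> (\<Sum>e\<in>(Basis::'a set). 2 * X)"
      unfolding W_def
    proof (rule sum_mono)
      fix e :: 'a assume e: "e \<in> Basis"
      have *: "d \<bullet> x \<le> X + d \<bullet> center_of_mass \<mu>"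
        if "x \<in> measure_support \<mu>" "norm d = 1" for x d
      proof -
        have "d \<bullet> (x - center_of_mass \<mu>) \<le> norm d * norm (x - center_of_mass \<mu>)"
          by (rule norm_cauchy_schwarz)
        moreover have "norm (x - center_of_mass \<mu>) \<le> X"
          using X that(1) by (force simp: dist_norm norm_minus_commute)
        ultimately show ?thesis using that(2) by (simp add: inner_diff_right)
      qed
      have "extent \<mu> e \<le> X + e \<bullet> center_of_mass \<mu>" "extent \<mu> (- e) \<le> X + (- e) \<bullet> center_of_mass \<mu>"
        using e by (auto intro!: extent_least * simp: norm_Basis simp del: inner_minus_left)
      then show "extent \<mu> e + extent \<mu> (- e) \<le> 2 * X" by simp
    qed
    then show "W / (2 * DIM('a)) \<le> X"
      by (simp add: field_simps)
  qed
  then show ?thesis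
    unfolding W_def by (simp add: field_simps)
qed

text \<open>Total width zero forces almost every point to coincide with the centre of mass, so the
  measure would be the Dirac mass there.\<close>

lemma width_pos:
  assumes "\<nexists>x. \<mu> = return borel x"
  shows "(\<Sum>e\<in>Basis. extent \<mu> e + extent \<mu> (- e)) > 0"
proof (rule ccontr)
  assume "\<not> ?thesis"
  then have le: "(\<Sum>e\<in>Basis. extent \<mu> e + extent \<mu> (- e)) \<le> 0" by simp
  define z where "z = center_of_mass \<mu>"
  have AE: "AE x in \<mu>. x = z"
    using AE_support by eventually_elim (use norm_diff_center_le[OF le] in \<open>auto simp: z_def\<close>)
  have "\<mu> = return borel z"
  proof (rule measure_eqI)
    fix A assume A: "A \<in> sets \<mu>"
    have "emeasure \<mu> A = (\<integral>\<^sup>+x. indicator A x \<partial>\<mu>)"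
      using A by simp
    also have "\<dots> = (\<integral>\<^sup>+x. indicator A z \<partial>\<mu>)"
      using AE by (intro nn_integral_cong_AE) auto
    also have "\<dots> = indicator A z"
      by (simp add: emeasure_space_1)
    finally show "emeasure \<mu> A = emeasure (return borel z) A"
      using A by (simp add: sets_eq)
  qed (simp add: sets_eq)
  with assms show False by blast
qed

end

subsection \<open>Exponential tilting\<close>

context prob_space
begin

lemma integrable_exp_times:
  fixes f g :: "'a \<Rightarrow> real"
  assumes [measurable]: "f \<in> borel_measurable M" "g \<in> borel_measurable M"
    and "AE x in M. \<bar>f x\<bar> \<le> B" "AE x in M. \<bar>g x\<bar> \<le> C"
  shows "integrable M (\<lambda>x. exp (real n * f x) * g x)"
proof (rule integrable_const_bound)
  show "AE x in M. norm (exp (real n * f x) * g x) \<le> exp (real n * B) * C"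
    using assms(3,4)
  proof eventually_elim
    case (elim x)
    then have "exp (real n * f x) * \<bar>g x\<bar> \<le> exp (real n * B) * C"
      by (intro mult_mono) (auto intro: mult_left_mono)
    then show ?case by (simp add: abs_mult)
  qed
qed measurable

lemma integrable_exp_scaled:
  fixes f :: "'a \<Rightarrow> real"
  assumes "f \<in> borel_measurable M" "AE x in M. \<bar>f x\<bar> \<le> B"
  shows "integrable M (\<lambda>x. exp (real n * f x))"
  using integrable_exp_times[of f "\<lambda>_. 1" B 1 n] assms by simp

text \<open>The Chernoff bound, used in reverse: a known mass above \<open>k\<close> bounds the
  exponential moment from below.\<close>

lemma expectation_exp_ge:
  fixes f :: "'a \<Rightarrow> real"
  assumes [measurable]: "f \<in> borel_measurable M" and "AE x in M. \<bar>f x\<bar> \<le> B"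
  shows "prob {x \<in> space M. k < f x} * exp (real n * k) \<le> expectation (\<lambda>x. exp (real n * f x))"
proof -
  have "expectation (\<lambda>x. indicator {x \<in> space M. k < f x} x * exp (real n * k))
      \<le> expectation (\<lambda>x. exp (real n * f x))"
  proof (rule integral_mono_AE)
    show "integrable M (\<lambda>x. exp (real n * f x))"
      by (rule integrable_exp_scaled[OF assms])
    show "integrable M (\<lambda>x. indicator {x \<in> space M. k < f x} x * exp (real n * k))"
      by (intro integrable_mult_left integrable_real_indicator) (auto simp: emeasure_eq_measure)
    show "AE x in M. indicator {x \<in> space M. k < f x} x * exp (real n * k) \<le> exp (real n * f x)"
      by (auto intro!: AE_I2 mult_left_mono simp: indicator_def)
  qed
  then show ?thesis by simp
qed

text \<open>The part where \<open>f\<close> is at most \<open>k\<close> carries unnormalised weight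
  at most exp(n k), while the normaliser is at least a positive constant times exp(n k'). Its share
  decays like exp(-(k' - k) n), so in the limit only values of \<open>g\<close> on
  \<open>k < f x\<close> count.\<close>

lemma tilted_average_ge:
  fixes f g :: "'a \<Rightarrow> real"
  assumes [measurable]: "f \<in> borel_measurable M" "g \<in> borel_measurable M"
    and f: "AE x in M. \<bar>f x\<bar> \<le> B" and g: "AE x in M. \<bar>g x\<bar> \<le> C"
    and \<beta>: "AE x in M. k < f x \<longrightarrow> \<beta> \<le> g x"
    and k: "k < k'" "prob {x \<in> space M. k' < f x} > 0" and "\<epsilon> > 0"
  shows "\<forall>\<^sub>F n in sequentially. \<beta> - \<epsilon> \<le>
    expectation (\<lambda>x. exp (real n * f x) * g x) / expectation (\<lambda>x. exp (real n * f x))"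
proof -
  define p where "p = prob {x \<in> space M. k' < f x}"
  define Z where "Z = (\<lambda>n. expectation (\<lambda>x. exp (real n * f x)))"
  have p: "p > 0" using k by (simp add: p_def)
  have Z: "p * exp (real n * k') \<le> Z n" for n
    unfolding p_def Z_def using expectation_exp_ge[OF _ f] by simp
  have C: "C \<ge> 0"
  proof (rule ccontr)
    assume "\<not> C \<ge> 0"
    have "AE x in M. False"
      using g by eventually_elim (use \<open>\<not> C \<ge> 0\<close> in linarith)
    then show False by simp
  qed
  have num: "- ((C + \<bar>\<beta>\<bar>) * exp (real n * k)) \<le>
      expectation (\<lambda>x. exp (real n * f x) * g x) - \<beta> * Z n" for n
  proof -
    have i: "integrable M (\<lambda>x. exp (real n * f x) * (g x - \<beta>))"
    proof (rule integrable_exp_times[OF _ _ f])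
      show "AE x in M. \<bar>g x - \<beta>\<bar> \<le> C + \<bar>\<beta>\<bar>"
        using g by eventually_elim linarith
    qed measurable
    have "(\<integral>x. - ((C + \<bar>\<beta>\<bar>) * exp (real n * k)) \<partial>M) \<le> (\<integral>x. exp (real n * f x) * (g x - \<beta>) \<partial>M)"
    proof (rule integral_mono_AE[OF _ i])
      show "AE x in M. - ((C + \<bar>\<beta>\<bar>) * exp (real n * k)) \<le> exp (real n * f x) * (g x - \<beta>)"
        using g \<beta>
      proof eventually_elim
        case (elim x)
        show ?case
        proof (cases "k < f x")
          case True
          then have "0 \<le> exp (real n * f x) * (g x - \<beta>)" using elim by simp
          moreover have "0 \<le> (C + \<bar>\<beta>\<bar>) * exp (real n * k)" using C by simp
          ultimately show ?thesis by linarith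
        next
          case False
          have "exp (real n * f x) * (\<beta> - g x) \<le> exp (real n * f x) * (C + \<bar>\<beta>\<bar>)"
            using elim by (intro mult_left_mono) auto
          also have "\<dots> \<le> exp (real n * k) * (C + \<bar>\<beta>\<bar>)"
            using False C by (intro mult_right_mono) (auto intro: mult_left_mono)
          finally show ?thesis by (simp add: algebra_simps)
        qed
      qed
    qed simp
    also have "\<dots> = expectation (\<lambda>x. exp (real n * f x) * g x) - \<beta> * Z n"
      unfolding right_diff_distrib Z_def
      by (subst Bochner_Integration.integral_diff)
        (auto intro!: integrable_exp_times[OF _ _ f g] integrable_exp_scaled[OF _ f])
    finally show ?thesis by (simp add: prob_space)
  qed
  have "(\<lambda>n. (C + \<bar>\<beta>\<bar>) / p * exp (- (k' - k) * real n)) \<longlonglongrightarrow> 0"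
    using k(1) by real_asymp
  then have "\<forall>\<^sub>F n in sequentially. (C + \<bar>\<beta>\<bar>) / p * exp (- (k' - k) * real n) < \<epsilon>"
    by (rule order_tendstoD) fact
  then show ?thesis
  proof eventually_elim
    case (elim n)
    have Zp: "Z n > 0" using Z[of n] p by (meson exp_gt_zero less_le_trans mult_pos_pos)
    have "(C + \<bar>\<beta>\<bar>) * exp (real n * k) = (C + \<bar>\<beta>\<bar>) / p * exp (- (k' - k) * real n) * (p * exp (real n * k'))"
      using p by (simp add: field_simps flip: exp_add)
    also have "\<dots> \<le> \<epsilon> * Z n"
      using elim Z p C \<open>\<epsilon> > 0\<close> by (intro mult_mono) auto
    finally have "(\<beta> - \<epsilon>) * Z n \<le> expectation (\<lambda>x. exp (real n * f x) * g x)"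
      using num[of n] by (simp add: algebra_simps)
    then show ?case
      using Zp by (simp add: Z_def field_simps)
  qed
qed

text \<open>Laplace's principle. The mass p above a level k < h contributes (ln p) / n + k, and the
  first term vanishes in the limit however small p is.\<close>

lemma log_laplace_tendsto:
  fixes f :: "'a \<Rightarrow> real"
  assumes [measurable]: "f \<in> borel_measurable M" and f: "AE x in M. \<bar>f x\<bar> \<le> B"
    and h: "AE x in M. f x \<le> h" "\<And>k. k < h \<Longrightarrow> prob {x \<in> space M. k < f x} > 0"
  shows "(\<lambda>n. ln (expectation (\<lambda>x. exp (real n * f x))) / real n) \<longlonglongrightarrow> h"
proof (rule order_tendstoI)
  define Z where "Z = (\<lambda>n. expectation (\<lambda>x. exp (real n * f x)))"
  have Zge: "prob {x \<in> space M. k < f x} * exp (real n * k) \<le> Z n" for n k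
    unfolding Z_def by (rule expectation_exp_ge[OF _ f]) simp
  have Zpos: "Z n > 0" for n
    using Zge[of "h - 1" n] h(2)[of "h - 1"] by (meson exp_gt_zero less_le_trans mult_pos_pos diff_less_eq less_add_one)
  {
    fix l assume "l < h"
    define k where "k = (l + h) / 2"
    have k: "l < k" "k < h" using \<open>l < h\<close> by (auto simp: k_def)
    define p where "p = prob {x \<in> space M. k < f x}"
    have p: "p > 0" using h(2)[OF k(2)] by (simp add: p_def)
    have "(\<lambda>n. ln p / real n + k) \<longlonglongrightarrow> k" by real_asymp
    then have "\<forall>\<^sub>F n in sequentially. l < ln p / real n + k"
      by (rule order_tendstoD) fact
    then show "\<forall>\<^sub>F n in sequentially. l < ln (expectation (\<lambda>x. exp (real n * f x))) / real n"
      using eventually_gt_at_top[of 0]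
    proof eventually_elim
      case (elim n)
      have "ln p + real n * k = ln (p * exp (real n * k))"
        using p by (simp add: ln_mult)
      also have "\<dots> \<le> ln (Z n)"
        using Zge[of k n] p Zpos[of n] by (simp add: p_def)
      finally have "(ln p + real n * k) / real n \<le> ln (Z n) / real n"
        by (intro divide_right_mono) auto
      then have "ln p / real n + k \<le> ln (Z n) / real n"
        using elim by (simp add: add_divide_distrib)
      then show ?case using elim by (simp add: Z_def)
    qed
  next
    fix l assume "h < l"
    show "\<forall>\<^sub>F n in sequentially. ln (expectation (\<lambda>x. exp (real n * f x))) / real n < l"
      using eventually_gt_at_top[of 0]
    proof eventually_elim
      case (elim n)
      have "Z n \<le> expectation (\<lambda>x. exp (real n * h))"
        unfolding Z_def
      proof (rule integral_mono_AE[OF integrable_exp_scaled[OF _ f]])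
        show "AE x in M. exp (real n * f x) \<le> exp (real n * h)"
          using h(1) by eventually_elim (auto intro: mult_left_mono)
      qed auto
      then have "Z n \<le> exp (real n * h)" by (simp add: prob_space)
      then have "ln (Z n) \<le> real n * h"
        using Zpos[of n] by (metis exp_le_cancel_iff exp_ln)
      then have "ln (Z n) / real n \<le> h" using elim by (simp add: field_simps)
      then show ?case using \<open>h < l\<close> by (simp add: Z_def)
    qed
  }
qed

end

subsection \<open>Integral equations on an interval\<close>

lemma set_integral_diff_atLeastAtMost:
  fixes f :: "real \<Rightarrow> real"
  assumes "set_integrable lborel {0..T} f" "0 \<le> s" "s \<le> t" "t \<le> T"
  shows "(LINT x:{0..t}|lborel. f x) - (LINT x:{0..s}|lborel. f x) = (LINT x:{s<..t}|lborel. f x)"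
proof -
  have "set_integrable lborel {0..s} f" "set_integrable lborel {s<..t} f"
    using assms by (auto intro!: set_integrable_subset[OF assms(1)])
  then have "(LINT x:{0..s} \<union> {s<..t}|lborel. f x) = (LINT x:{0..s}|lborel. f x) + (LINT x:{s<..t}|lborel. f x)"
    by (intro set_integral_Un) auto
  moreover have "{0..s} \<union> {s<..t} = {0..t}" using assms by auto
  ultimately show ?thesis by simp
qed

lemma set_integral_abs_le:
  fixes f :: "real \<Rightarrow> real"
  assumes "set_integrable lborel {s<..t} f" "\<And>x. s < x \<Longrightarrow> x \<le> t \<Longrightarrow> \<bar>f x\<bar> \<le> C" "s \<le> t"
  shows "\<bar>LINT x:{s<..t}|lborel. f x\<bar> \<le> C * (t - s)"
proof -
  have c: "set_integrable lborel {s<..t} (\<lambda>x. c)" for c :: real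
    unfolding set_integrable_def using \<open>s \<le> t\<close> by simp
  have e: "(LINT x:{s<..t}|lborel. c) = c * (t - s)" for c :: real
    using \<open>s \<le> t\<close> by (simp add: set_integral_const)
  have "(LINT x:{s<..t}|lborel. f x) \<le> (LINT x:{s<..t}|lborel. C)"
    using assms(2) by (intro set_integral_mono assms(1) c) fastforce
  moreover have "(LINT x:{s<..t}|lborel. - C) \<le> (LINT x:{s<..t}|lborel. f x)"
    using assms(2) by (intro set_integral_mono assms(1) c) fastforce
  ultimately show ?thesis unfolding e by simp
qed

lemma continuous_on_set_integral:
  fixes f :: "real \<Rightarrow> real"
  assumes "set_integrable lborel {0..T} f"
  shows "continuous_on {0..T} (\<lambda>t. LINT x:{0..t}|lborel. f x)"
proof -
  have "set_integrable lborel {0..t} f" if "t \<le> T" for t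
    using that by (intro set_integrable_subset[OF assms]) auto
  then have eq: "integral {0..t} f = (LINT x:{0..t}|lborel. f x)" if "t \<in> {0..T}" for t
    using that by (intro set_borel_integral_eq_integral(2)[symmetric]) auto
  have "continuous_on {0..T} (\<lambda>t. integral {0..t} f)"
    by (intro indefinite_integral_continuous_1 set_borel_integral_eq_integral(1) assms)
  then show ?thesis
    by (rule continuous_on_eq) (rule eq)
qed

text \<open>Difference quotients are at most K |t - s|, so the derivative vanishes everywhere. This
  serves to verify integral identities whose two sides need not be differentiable.\<close>

lemma constant_if_quadratic_bound:
  fixes f :: "real \<Rightarrow> real"
  assumes "convex S" "\<And>s t. s \<in> S \<Longrightarrow> t \<in> S \<Longrightarrow> s \<le> t \<Longrightarrow> \<bar>f t - f s\<bar> \<le> K * (t - s)\<^sup>2" "s \<in> S" "t \<in> S"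
  shows "f s = f t"
proof -
  have q: "\<bar>f y - f x\<bar> \<le> K * \<bar>y - x\<bar> * \<bar>y - x\<bar>" if "x \<in> S" "y \<in> S" for x y
    using assms(2)[OF that] assms(2)[OF that(2,1)]
    by (cases "x \<le> y") (auto simp: power2_eq_square algebra_simps abs_minus_commute)
  have "(f has_field_derivative 0) (at x within S)" if "x \<in> S" for x
    unfolding has_field_derivative_iff
  proof (rule Lim_null_comparison)
    show "\<forall>\<^sub>F y in at x within S. norm ((f y - f x) / (y - x)) \<le> K * \<bar>y - x\<bar>"
      unfolding eventually_at_filter
      using q[OF that] by (auto simp: divide_simps)
    have "((\<lambda>y. K * \<bar>y - x\<bar>) \<longlongrightarrow> K * \<bar>x - x\<bar>) (at x within S)"
      by (intro tendsto_intros)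
    then show "((\<lambda>y. K * \<bar>y - x\<bar>) \<longlongrightarrow> 0) (at x within S)" by simp
  qed
  then obtain c where "\<forall>x\<in>S. f x = c"
    using has_field_derivative_zero_constant[OF assms(1)] by blast
  then show ?thesis using assms by simp
qed

text \<open>The inequality ln x \<le> x - 1 at b/a and at a/b traps ln b - ln a between (b - a)/b
  and (b - a)/a, which differ by (b - a)^2 / (a b).\<close>

lemma ln_diff_approx:
  fixes a b \<delta> :: real
  assumes "0 < \<delta>" "\<delta> \<le> a" "\<delta> \<le> b"
  shows "\<bar>ln b - ln a - (b - a) / a\<bar> \<le> (b - a)\<^sup>2 / \<delta>\<^sup>2"
proof -
  have pos: "0 < a" "0 < b" using assms by auto
  have "ln (b / a) \<le> b / a - 1" "ln (a / b) \<le> a / b - 1"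
    using pos by (auto intro!: ln_le_minus_one)
  then have 1: "ln b - ln a \<le> (b - a) / a" "ln a - ln b \<le> (a - b) / b"
    using pos by (auto simp: ln_div diff_divide_distrib)
  have "(b - a) / a - (b - a) / b = (b - a)\<^sup>2 / (a * b)"
    using pos by (simp add: divide_simps power2_eq_square) (simp add: algebra_simps)
  also have "\<dots> \<le> (b - a)\<^sup>2 / \<delta>\<^sup>2"
    using assms unfolding power2_eq_square[of \<delta>]
    by (intro divide_left_mono mult_mono mult_pos_pos) auto
  finally have 2: "(b - a) / a - (b - a) / b \<le> (b - a)\<^sup>2 / \<delta>\<^sup>2" .
  have "(a - b) / b = - ((b - a) / b)" by (simp add: diff_divide_distrib)
  moreover have "0 \<le> (b - a)\<^sup>2 / \<delta>\<^sup>2" by simp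
  ultimately show ?thesis using 1 2 unfolding abs_le_iff by linarith
qed

text \<open>The chain rule (ln F)' = z / F in integrated form. Since \<open>z\<close> is only
  bounded and integrable, \<open>F\<close> may fail to be differentiable at some points; instead,
  the difference of the two sides is shown to have increments of second order, so it is
  constant.\<close>

lemma ln_of_integral:
  fixes F z :: "real \<Rightarrow> real"
  assumes z: "set_integrable lborel {0..T} z" "\<And>s. s \<in> {0..T} \<Longrightarrow> \<bar>z s\<bar> \<le> C"
    and F: "\<And>t. t \<in> {0..T} \<Longrightarrow> F t = F 0 + (LINT s:{0..t}|lborel. z s)"
    and \<delta>: "\<delta> > 0" "\<And>t. t \<in> {0..T} \<Longrightarrow> \<delta> \<le> F t"
  shows "set_integrable lborel {0..T} (\<lambda>s. z s / F s)"
    and "t \<in> {0..T} \<Longrightarrow> ln (F t) - ln (F 0) = (LINT s:{0..t}|lborel. z s / F s)"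
proof -
  have sub: "set_integrable lborel {s<..t} z" if "0 \<le> s" "t \<le> T" for s t
    using that by (intro set_integrable_subset[OF z(1)]) auto
  have cont: "continuous_on {0..T} F"
    using continuous_on_add[OF continuous_on_const continuous_on_set_integral[OF z(1)], of "F 0"]
    by (rule continuous_on_eq) (rule F[symmetric])
  have pos: "F t > 0" if "t \<in> {0..T}" for t
    using \<delta>(1) \<delta>(2)[OF that] by linarith
  show int: "set_integrable lborel {0..T} (\<lambda>s. z s / F s)"
  proof -
    have "continuous_on {0..T} (\<lambda>s. 1 / F s)"
      by (intro continuous_intros cont) (use pos in force)
    then have m: "(\<lambda>s. indicator {0..T} s *\<^sub>R (1 / F s)) \<in> borel_measurable borel"
      by (intro borel_measurable_continuous_on_indicator) auto
    \<comment> \<open>The indicator stands on both factors: cut off in this way, 1 / F is measurable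
      by continuity on the interval alone, and the product is unchanged.\<close>
    have "integrable lborel (\<lambda>s. (indicator {0..T} s *\<^sub>R z s) * (indicator {0..T} s *\<^sub>R (1 / F s)))"
    proof (rule Bochner_Integration.integrable_bound)
      show "integrable lborel (\<lambda>s. (indicator {0..T} s *\<^sub>R z s) * (1 / \<delta>))"
        using z(1) unfolding set_integrable_def by simp
      show "(\<lambda>s. (indicator {0..T} s *\<^sub>R z s) * (indicator {0..T} s *\<^sub>R (1 / F s))) \<in> borel_measurable lborel"
        using m borel_measurable_integrable[OF z(1)[unfolded set_integrable_def]]
        by (intro borel_measurable_times) simp_all
      show "AE s in lborel. norm ((indicator {0..T} s *\<^sub>R z s) * (indicator {0..T} s *\<^sub>R (1 / F s)))
          \<le> norm ((indicator {0..T} s *\<^sub>R z s) * (1 / \<delta>))"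
      proof (rule AE_I2)
        fix s :: real
        show "norm ((indicator {0..T} s *\<^sub>R z s) * (indicator {0..T} s *\<^sub>R (1 / F s)))
          \<le> norm ((indicator {0..T} s *\<^sub>R z s) * (1 / \<delta>))"
        proof (cases "s \<in> {0..T}")
          case True
          then have "\<bar>z s\<bar> / F s \<le> \<bar>z s\<bar> / \<delta>"
            using \<delta>(2)[OF True] pos[OF True] \<delta>(1) by (intro divide_left_mono) auto
          then show ?thesis using True pos[OF True] \<delta>(1) by (simp add: abs_mult)
        qed simp
      qed
    qed
    then show ?thesis
      unfolding set_integrable_def
      by (rule Bochner_Integration.integrable_cong[THEN iffD1, rotated 2]) (auto simp: indicator_def)
  qed
  define D where "D = (\<lambda>t. ln (F t) - (LINT s:{0..t}|lborel. z s / F s))"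
  have lip: "\<bar>F t - F s\<bar> \<le> C * (t - s)" if "0 \<le> s" "s \<le> t" "t \<le> T" for s t
  proof -
    have "F t - F s = (LINT x:{s<..t}|lborel. z x)"
      using that F[of t] F[of s] set_integral_diff_atLeastAtMost[OF z(1) that] by simp
    then show ?thesis
      using that set_integral_abs_le[OF sub, of s t C] z(2) by simp
  qed
  have quad: "\<bar>D t - D s\<bar> \<le> 2 * C\<^sup>2 / \<delta>\<^sup>2 * (t - s)\<^sup>2" if st: "s \<in> {0..T}" "t \<in> {0..T}" "s \<le> t" for s t
  proof -
    have r: "0 \<le> s" "s \<le> t" "t \<le> T" using st by auto
    have C: "C \<ge> 0" using z(2)[OF st(1)] by linarith
    have i: "set_integrable lborel {s<..t} (\<lambda>x. z x / F x)"
      using st by (intro set_integrable_subset[OF int]) auto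
    have i2: "set_integrable lborel {s<..t} (\<lambda>x. z x / F s)"
      using sub[of s t] r by (auto simp: set_integrable_def)
    \<comment> \<open>Freezing the denominator at \<open>F s\<close> costs at most a multiple of t -
      s by the Lipschitz bound on \<open>F\<close>; integrating over the interval yields the second
      factor t - s.\<close>
    have "\<bar>LINT x:{s<..t}|lborel. z x / F x - z x / F s\<bar> \<le> (C * (C * (t - s)) / \<delta>\<^sup>2) * (t - s)"
    proof (rule set_integral_abs_le)
      show "set_integrable lborel {s<..t} (\<lambda>x. z x / F x - z x / F s)"
        using i i2 by (rule set_integral_diff)
      fix x assume x: "s < x" "x \<le> t"
      then have xT: "x \<in> {0..T}" using st by auto
      have "z x / F x - z x / F s = z x * (F s - F x) / (F x * F s)"
        using pos[OF xT] pos[OF st(1)] by (simp add: field_simps)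
      then have "\<bar>z x / F x - z x / F s\<bar> = \<bar>z x\<bar> * \<bar>F x - F s\<bar> / (F x * F s)"
        using pos[OF xT] pos[OF st(1)] by (simp add: abs_mult abs_minus_commute)
      also have "\<dots> \<le> C * (C * (t - s)) / \<delta>\<^sup>2"
      proof (rule frac_le)
        have "\<bar>F x - F s\<bar> \<le> C * (x - s)" using x r by (intro lip) auto
        also have "\<dots> \<le> C * (t - s)" using x C by (intro mult_left_mono) auto
        finally show "\<bar>z x\<bar> * \<bar>F x - F s\<bar> \<le> C * (C * (t - s))"
          using z(2)[OF xT] C by (intro mult_mono) auto
        show "\<delta>\<^sup>2 \<le> F x * F s"
          unfolding power2_eq_square using \<delta>(1) \<delta>(2)[OF xT] \<delta>(2)[OF st(1)] by (intro mult_mono) auto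
      qed (use \<delta> C r in auto)
      finally show "\<bar>z x / F x - z x / F s\<bar> \<le> C * (C * (t - s)) / \<delta>\<^sup>2" .
    qed (use st in auto)
    also have "(LINT x:{s<..t}|lborel. z x / F x - z x / F s) =
        (LINT x:{s<..t}|lborel. z x / F x) - (LINT x:{s<..t}|lborel. z x / F s)"
      using i i2 by (rule set_integral_diff)
    also have "(LINT x:{s<..t}|lborel. z x / F s) = (F t - F s) / F s"
      using F[of t] F[of s] st set_integral_diff_atLeastAtMost[OF z(1) r] by simp
    finally have A: "\<bar>(LINT x:{s<..t}|lborel. z x / F x) - (F t - F s) / F s\<bar> \<le> C\<^sup>2 / \<delta>\<^sup>2 * (t - s)\<^sup>2"
      by (simp add: power2_eq_square mult_ac)
    have "\<bar>ln (F t) - ln (F s) - (F t - F s) / F s\<bar> \<le> (F t - F s)\<^sup>2 / \<delta>\<^sup>2"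
      by (intro ln_diff_approx \<delta> st)
    also have "\<dots> \<le> (C * (t - s))\<^sup>2 / \<delta>\<^sup>2"
      using lip[OF r] by (intro divide_right_mono) (auto simp: abs_le_square_iff[symmetric])
    finally have B: "\<bar>ln (F t) - ln (F s) - (F t - F s) / F s\<bar> \<le> C\<^sup>2 / \<delta>\<^sup>2 * (t - s)\<^sup>2"
      by (simp add: power_mult_distrib)
    have "D t - D s = ln (F t) - ln (F s) - (LINT x:{s<..t}|lborel. z x / F x)"
      using set_integral_diff_atLeastAtMost[OF int r] by (simp add: D_def)
    then show ?thesis using A B by (simp add: abs_le_iff)
  qed
  {
    assume t: "t \<in> {0..T}"
    have "D 0 = D t"
      using t by (intro constant_if_quadratic_bound[of "{0..T}" D, OF _ quad]) auto
    moreover have "(LINT s:{0..0}|lborel. z s / F s) = 0"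
      using set_borel_integral_eq_integral(2)[OF set_integrable_subset[OF int, of "{0..0}"]] t by simp
    ultimately show "ln (F t) - ln (F 0) = (LINT s:{0..t}|lborel. z s / F s)"
      by (simp add: D_def)
  }
qed

lemma gronwall_integral:
  fixes F z :: "real \<Rightarrow> real"
  assumes z: "set_integrable lborel {0..T} z" "\<And>s. s \<in> {0..T} \<Longrightarrow> z s \<le> K * F s"
    and F: "\<And>t. t \<in> {0..T} \<Longrightarrow> F t = F 0 + (LINT s:{0..t}|lborel. z s)"
    and "K \<ge> 0" "T \<ge> 0"
  shows "F T \<le> F 0 * exp (K * T)"
proof (cases "T = 0")
  case False
  with \<open>T \<ge> 0\<close> have T: "T > 0" by simp
  have cont: "continuous_on {0..T} F"
    using continuous_on_add[OF continuous_on_const continuous_on_set_integral[OF z(1)], of "F 0"]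
    by (rule continuous_on_eq) (rule F[symmetric])
  have intF: "set_integrable lborel {0..t} F" if "t \<le> T" for t
    using that by (intro borel_integrable_atLeastAtMost' continuous_on_subset[OF cont]) auto
  \<comment> \<open>A majorant of \<open>F\<close> that is differentiable although \<open>F\<close>
    is only continuous. Its derivative K F is at most K g, so g exp(-K t) does not increase.\<close>
  define g where "g = (\<lambda>t. F 0 + K * integral {0..t} F)"
  have Fg: "F t \<le> g t" if "t \<in> {0..T}" for t
  proof -
    have "F t = F 0 + (LINT s:{0..t}|lborel. z s)" by (rule F[OF that])
    also have "(LINT s:{0..t}|lborel. z s) \<le> (LINT s:{0..t}|lborel. K * F s)"
      using that z(2) intF[of t]
      by (intro set_integral_mono set_integrable_subset[OF z(1)] set_integrable_mult_right) auto
    also have "\<dots> = K * integral {0..t} F"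
      using set_borel_integral_eq_integral(2)[OF intF[of t]] that by simp
    finally show ?thesis by (simp add: g_def)
  qed
  have dg: "(g has_real_derivative K * F t) (at t within {0..T})" if "t \<in> {0..T}" for t
    unfolding g_def using that
    by (auto intro!: derivative_eq_intros integral_has_real_derivative[OF cont])
  have "g T * exp (- K * T) \<le> g 0 * exp (- K * 0)"
  proof (rule DERIV_nonpos_imp_decreasing_open[where f = "\<lambda>t. g t * exp (- K * t)"])
    fix t assume t: "0 < t" "t < T"
    then have d: "(g has_real_derivative K * F t) (at t)"
      using dg[of t] at_within_Icc_at[of 0 t T] by simp
    have "((\<lambda>t. g t * exp (- K * t)) has_real_derivative K * (F t - g t) * exp (- K * t)) (at t)"
      by (auto intro!: derivative_eq_intros d simp: algebra_simps)
    moreover have "K * (F t - g t) * exp (- K * t) \<le> 0"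
      using Fg[of t] t \<open>K \<ge> 0\<close> by (intro mult_nonpos_nonneg mult_nonneg_nonpos) auto
    ultimately show "\<exists>y. ((\<lambda>t. g t * exp (- K * t)) has_real_derivative y) (at t) \<and> y \<le> 0" by blast
  next
    have "continuous_on {0..T} g"
      using dg by (meson DERIV_continuous continuous_on_eq_continuous_within)
    then show "continuous_on {0..T} (\<lambda>t. g t * exp (- K * t))"
      by (intro continuous_intros)
  qed (use T in simp)
  then have "g T * exp (- (K * T)) \<le> F 0" by (simp add: g_def)
  then have "g T \<le> F 0 * exp (K * T)"
    by (simp add: exp_minus field_simps)
  then show ?thesis using Fg[of T] T by simp
qed simp

subsection \<open>Cutoffs and Lipschitz test functions\<close>

text \<open>Squaring removes the kink of the positive part; the result is the C^1 building block of
  the cutoff.\<close>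

lemma DERIV_max_0_square:
  "((\<lambda>x::real. (max 0 x)\<^sup>2) has_real_derivative 2 * max 0 x) (at x)"
proof -
  consider "x < 0" | "x > 0" | "x = 0" by linarith
  then show ?thesis
  proof cases
    case 1
    have "((\<lambda>x::real. 0) has_real_derivative 2 * max 0 x) (at x)"
      using 1 by (auto intro!: derivative_eq_intros)
    then show ?thesis
      by (rule has_field_derivative_transform_within_open[of _ _ _ "{..<0}"]) (use 1 in auto)
  next
    case 2
    have "((\<lambda>x::real. x\<^sup>2) has_real_derivative 2 * max 0 x) (at x)"
      using 2 by (auto intro!: derivative_eq_intros)
    then show ?thesis
      by (rule has_field_derivative_transform_within_open[of _ _ _ "{0<..}"]) (use 2 in auto)
  next
    case 3
    have "(\<lambda>y. ((max 0 y)\<^sup>2 - (max 0 x)\<^sup>2) / (y - x)) \<midarrow>x\<rightarrow> 0"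
    proof (rule Lim_null_comparison)
      show "\<forall>\<^sub>F y in at x. norm (((max 0 y)\<^sup>2 - (max 0 x)\<^sup>2) / (y - x)) \<le> \<bar>y\<bar>"
        using 3 by (auto simp: max_def power2_eq_square)
      show "(\<lambda>y. \<bar>y\<bar>) \<midarrow>x\<rightarrow> 0"
        using 3 tendsto_rabs[OF tendsto_ident_at, of x UNIV] by simp
    qed
    then show ?thesis
      using 3 by (simp add: has_field_derivative_iff)
  qed
qed

text \<open>Two nested squared positive parts give an explicit C^1 function that is 1 for norm at
  most R and vanishes once the squared norm reaches 2 R^2. Taking x.x as argument keeps it
  differentiable at the origin.\<close>

definition cutoff :: "real \<Rightarrow> 'a::euclidean_space \<Rightarrow> real" where
  "cutoff R x = (max 0 (1 - (max 0 ((x \<bullet> x) / R\<^sup>2 - 1))\<^sup>2))\<^sup>2"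

definition cutoff_grad :: "real \<Rightarrow> 'a::euclidean_space \<Rightarrow> 'a" where
  "cutoff_grad R x = (2 * max 0 (1 - (max 0 ((x \<bullet> x) / R\<^sup>2 - 1))\<^sup>2) *
     (- (2 * max 0 ((x \<bullet> x) / R\<^sup>2 - 1)) * (2 / R\<^sup>2))) *\<^sub>R x"

lemma GDERIV_cutoff: "GDERIV (cutoff R) x :> cutoff_grad R x"
proof -
  define p where "p = (\<lambda>s::real. (max 0 (1 - (max 0 (s / R\<^sup>2 - 1))\<^sup>2))\<^sup>2)"
  have inner: "GDERIV (\<lambda>x::'a. x \<bullet> x) x :> 2 *\<^sub>R x" for x :: 'a
    unfolding gderiv_def
    by (auto intro!: derivative_eq_intros simp: inner_commute)
  have "(p has_real_derivative 2 * max 0 (1 - (max 0 (s / R\<^sup>2 - 1))\<^sup>2) *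
     (- (2 * max 0 (s / R\<^sup>2 - 1) * (1 / R\<^sup>2)))) (at s)" for s
  proof -
    have "((\<lambda>s. s / R\<^sup>2 - 1) has_real_derivative 1 / R\<^sup>2 - 0) (at s)"
      by (intro DERIV_diff DERIV_const DERIV_cdivide DERIV_ident)
    then have 1: "((\<lambda>s. s / R\<^sup>2 - 1) has_real_derivative 1 / R\<^sup>2) (at s)"
      by simp
    have "((\<lambda>s. 1 - (max 0 (s / R\<^sup>2 - 1))\<^sup>2) has_real_derivative
        0 - 2 * max 0 (s / R\<^sup>2 - 1) * (1 / R\<^sup>2)) (at s)"
      by (intro DERIV_diff DERIV_const DERIV_chain2[OF DERIV_max_0_square 1])
    then have 2: "((\<lambda>s. 1 - (max 0 (s / R\<^sup>2 - 1))\<^sup>2) has_real_derivative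
        - (2 * max 0 (s / R\<^sup>2 - 1) * (1 / R\<^sup>2))) (at s)"
      by simp
    show ?thesis
      unfolding p_def by (rule DERIV_chain2[OF DERIV_max_0_square 2])
  qed
  from GDERIV_DERIV_compose[OF inner[of x] this]
  show ?thesis
    unfolding p_def cutoff_def cutoff_grad_def by (simp add: algebra_simps)
qed

lemma continuous_cutoff_grad: "R > 0 \<Longrightarrow> continuous_on UNIV (cutoff_grad R)"
  unfolding cutoff_grad_def[abs_def] by (intro continuous_intros) auto

lemma cutoff_bounds: "0 \<le> cutoff R x" "cutoff R x \<le> 1"
  unfolding cutoff_def by (auto intro!: power_le_one)

lemma
  assumes "R > 0" "norm x \<le> R"
  shows cutoff_inside: "cutoff R x = 1" and cutoff_grad_inside: "cutoff_grad R x = 0"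
proof -
  have "(norm x)\<^sup>2 \<le> R\<^sup>2" using assms by (intro power_mono) auto
  then have "max 0 ((x \<bullet> x) / R\<^sup>2 - 1) = 0"
    using assms by (simp add: dot_square_norm divide_simps max_def)
  then show "cutoff R x = 1" "cutoff_grad R x = 0"
    by (auto simp: cutoff_def cutoff_grad_def)
qed

lemma
  assumes "R > 0" "2 * R \<le> norm x"
  shows cutoff_outside: "cutoff R x = 0" and cutoff_grad_outside: "cutoff_grad R x = 0"
proof -
  have "(2 * R)\<^sup>2 \<le> (norm x)\<^sup>2" using assms by (intro power_mono) auto
  then have "4 \<le> (x \<bullet> x) / R\<^sup>2"
    using assms by (simp add: dot_square_norm le_divide_eq power_mult_distrib)
  then have "1 \<le> (max 0 ((x \<bullet> x) / R\<^sup>2 - 1))\<^sup>2"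
    by (intro one_le_power) auto
  then have "max 0 (1 - (max 0 ((x \<bullet> x) / R\<^sup>2 - 1))\<^sup>2) = 0" by simp
  then show "cutoff R x = 0" "cutoff_grad R x = 0"
    by (auto simp: cutoff_def cutoff_grad_def)
qed

text \<open>The scalar factor is at most 8 / R^2 and vanishes unless the norm of x is below 2R. The
  decay 1 / R is what compensates the linear growth of a Lipschitz test function.\<close>

lemma norm_cutoff_grad:
  assumes "R > 0"
  shows "norm (cutoff_grad R x) \<le> 16 / R"
proof (cases "norm x < 2 * R")
  case True
  define m where "m = max 0 ((x \<bullet> x) / R\<^sup>2 - 1)"
  have "\<bar>2 * max 0 (1 - m\<^sup>2) * (- (2 * m) * (2 / R\<^sup>2))\<bar> = 8 / R\<^sup>2 * (max 0 (1 - m\<^sup>2) * m)"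
    by (simp add: abs_mult m_def)
  also have "\<dots> \<le> 8 / R\<^sup>2 * 1"
  proof (intro mult_left_mono)
    have "m \<ge> 0" by (simp add: m_def)
    show "max 0 (1 - m\<^sup>2) * m \<le> 1"
    proof (cases "m \<le> 1")
      case True
      then show ?thesis using \<open>m \<ge> 0\<close> by (intro mult_le_one) auto
    next
      case False
      then have "1 - m\<^sup>2 \<le> 0" using one_le_power[of m 2] by simp
      then show ?thesis by simp
    qed
  qed simp
  finally have *: "\<bar>2 * max 0 (1 - m\<^sup>2) * (- (2 * m) * (2 / R\<^sup>2))\<bar> \<le> 8 / R\<^sup>2" by simp
  have "norm (cutoff_grad R x) = \<bar>2 * max 0 (1 - m\<^sup>2) * (- (2 * m) * (2 / R\<^sup>2))\<bar> * norm x"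
    unfolding cutoff_grad_def m_def by (rule norm_scaleR)
  also have "\<dots> \<le> 8 / R\<^sup>2 * norm x"
    by (intro mult_right_mono * norm_ge_zero)
  also have "\<dots> \<le> 8 / R\<^sup>2 * (2 * R)"
    using True by (intro mult_left_mono) auto
  also have "\<dots> = 16 / R"
    using assms by (simp add: power2_eq_square)
  finally show ?thesis .
qed (use assms in \<open>simp add: cutoff_grad_outside\<close>)

section \<open>Weak formulation for Lipschitz test functions\<close>

lemma lipschitz_growth:
  fixes \<phi> :: "'a::euclidean_space \<Rightarrow> real"
  assumes "\<And>x. GDERIV \<phi> x :> \<phi>' x" "\<And>x. norm (\<phi>' x) \<le> C"
  shows "\<bar>\<phi> x\<bar> \<le> \<bar>\<phi> 0\<bar> + C * norm x"
proof -
  have "norm (\<phi> x - \<phi> 0) \<le> C * norm (x - 0)"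
  proof (rule differentiable_bound[of UNIV \<phi> "\<lambda>x h. h \<bullet> \<phi>' x"])
    fix y
    show "(\<phi> has_derivative (\<lambda>h. h \<bullet> \<phi>' y)) (at y within UNIV)"
      using assms(1)[of y] by (simp add: gderiv_def)
    show "onorm (\<lambda>h. h \<bullet> \<phi>' y) \<le> C"
    proof (rule onorm_le)
      fix h
      have "norm (h \<bullet> \<phi>' y) \<le> norm h * norm (\<phi>' y)"
        using Cauchy_Schwarz_ineq2 by simp
      also have "\<dots> \<le> norm h * C"
        by (intro mult_left_mono assms) simp
      finally show "norm (h \<bullet> \<phi>' y) \<le> C * norm h" by (simp add: mult.commute)
    qed
  qed auto
  then show ?thesis by simp
qed

text \<open>Multiplying by the cutoff makes \<phi> admissible, and the product has a gradient
  bounded independently of the radius. For each fixed time the truncation is eventually invisible,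
  because the support is compact at that time; the index may depend on the time, since dominated
  convergence with the integrable mean speed does the rest.\<close>

lemma
  fixes \<phi> :: "'a::euclidean_space \<Rightarrow> real" and \<mu> :: "real \<Rightarrow> 'a measure"
  assumes ce: "continuity_equation \<mu> v"
    and cp: "\<And>s. 0 \<le> s \<Longrightarrow> compact_prob (\<mu> s)"
    and v: "\<And>s. 0 \<le> s \<Longrightarrow> integrable (\<mu> s) (v s)"
    and \<phi>: "\<And>x. GDERIV \<phi> x :> \<phi>' x" "continuous_on UNIV \<phi>'" "\<And>x. norm (\<phi>' x) \<le> C"
    and t: "0 \<le> t"
  shows continuity_equation_lipschitz_integrable:
      "set_integrable lborel {0..t} (\<lambda>s. \<integral>x. \<phi>' x \<bullet> v s x \<partial>\<mu> s)"
    and continuity_equation_lipschitz: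
      "(\<integral>x. \<phi> x \<partial>\<mu> t) = (\<integral>x. \<phi> x \<partial>\<mu> 0) + (LINT s:{0..t}|lborel. (\<integral>x. \<phi>' x \<bullet> v s x \<partial>\<mu> s))"
proof -
  define \<psi> where "\<psi> = (\<lambda>n x. cutoff (real (Suc n)) x * \<phi> x)"
  define \<psi>' where "\<psi>' = (\<lambda>n x. cutoff (real (Suc n)) x *\<^sub>R \<phi>' x + \<phi> x *\<^sub>R cutoff_grad (real (Suc n)) x)"
  \<comment> \<open>The first term bounds cutoff times gradient. The rest is (|\<phi>(0)| R + 2 R C)
    times 16 / R, bounding \<phi> on norms below 2R; the radius \<open>Suc n\<close> is at least 1,
    so |\<phi>(0)| \<le> |\<phi>(0)| R.\<close>
  define K where "K = C + (16 * \<bar>\<phi> 0\<bar> + 32 * C)"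
  define S where "S = (\<lambda>n s. \<integral>x. \<psi>' n x \<bullet> v s x \<partial>\<mu> s)"
  define F where "F = (\<lambda>s. \<integral>x. \<phi>' x \<bullet> v s x \<partial>\<mu> s)"
  have C: "C \<ge> 0" using \<phi>(3)[of 0] norm_ge_zero order_trans by blast
  have cont_GDERIV: "continuous_on UNIV f" if "\<And>x. GDERIV f x :> f' x"
    for f :: "'a \<Rightarrow> real" and f'
    using that unfolding gderiv_def
    by (intro continuous_at_imp_continuous_on ballI has_derivative_continuous) blast
  have cont_\<phi>: "continuous_on UNIV \<phi>" by (rule cont_GDERIV[OF \<phi>(1)])
  have cont_\<psi>': "continuous_on UNIV (\<psi>' n)" for n
    unfolding \<psi>'_def by (intro continuous_intros \<phi>(2) cont_\<phi> continuous_cutoff_grad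
        cont_GDERIV[OF GDERIV_cutoff]) simp
  have test: "test_function (\<psi> n) (\<psi>' n)" for n
    unfolding test_function_def
  proof (intro conjI allI cont_\<psi>')
    show "GDERIV (\<psi> n) x :> \<psi>' n x" for x
      unfolding \<psi>_def \<psi>'_def by (rule GDERIV_mult[OF GDERIV_cutoff \<phi>(1)])
    have "{x. \<psi> n x \<noteq> 0} \<subseteq> cball 0 (2 * real (Suc n))"
    proof
      fix x assume "x \<in> {x. \<psi> n x \<noteq> 0}"
      then have "\<not> 2 * real (Suc n) \<le> norm x"
        using cutoff_outside[of "real (Suc n)" x] by (auto simp: \<psi>_def)
      then show "x \<in> cball 0 (2 * real (Suc n))" by simp
    qed
    then show "compact (closure {x. \<psi> n x \<noteq> 0})"
      by (metis bounded_cball bounded_subset compact_closure)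
  qed
  have K: "norm (\<psi>' n x) \<le> K" for n x
  proof -
    define R where "R = real (Suc n)"
    have R: "R \<ge> 1" by (simp add: R_def)
    have "norm (cutoff R x *\<^sub>R \<phi>' x) \<le> 1 * C"
      unfolding norm_scaleR using cutoff_bounds[of R x] \<phi>(3) by (intro mult_mono) auto
    moreover have "norm (\<phi> x *\<^sub>R cutoff_grad R x) \<le> 16 * \<bar>\<phi> 0\<bar> + 32 * C"
    proof (cases "norm x < 2 * R")
      case True
      have "\<bar>\<phi> x\<bar> \<le> \<bar>\<phi> 0\<bar> + C * norm x" by (rule lipschitz_growth[OF \<phi>(1,3)])
      also have "\<dots> \<le> \<bar>\<phi> 0\<bar> * R + C * (2 * R)"
        using True R C by (intro add_mono mult_left_mono) (auto simp: mult_le_cancel_left1)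
      finally have "norm (\<phi> x *\<^sub>R cutoff_grad R x) \<le> (\<bar>\<phi> 0\<bar> * R + C * (2 * R)) * (16 / R)"
        unfolding norm_scaleR using norm_cutoff_grad[of R x] R by (intro mult_mono) auto
      also have "\<dots> = 16 * \<bar>\<phi> 0\<bar> + 32 * C"
        using R by (simp add: field_simps)
      finally show ?thesis .
    next
      case False
      then show ?thesis using R C cutoff_grad_outside[of R x] by simp
    qed
    ultimately show ?thesis
      unfolding \<psi>'_def R_def[symmetric] K_def by (intro norm_triangle_le) simp
  qed
  have ce': "set_integrable lborel {0..t} (S n)"
      "(\<integral>x. \<psi> n x \<partial>\<mu> t) = (\<integral>x. \<psi> n x \<partial>\<mu> 0) + (LINT s:{0..t}|lborel. S n s)" for n
    using ce test[of n] t unfolding continuity_equation_def S_def by blast+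
  have ev: "\<forall>\<^sub>F n in sequentially. \<forall>x\<in>measure_support (\<mu> s). \<psi> n x = \<phi> x \<and> \<psi>' n x = \<phi>' x"
    if s: "0 \<le> s" for s
  proof -
    obtain R0 where R0: "\<And>x. x \<in> measure_support (\<mu> s) \<Longrightarrow> norm x \<le> R0"
      using compact_prob.norm_support_bound[OF cp[OF s]] by metis
    have "\<forall>\<^sub>F n in sequentially. R0 \<le> real n"
      by (simp add: eventually_sequentially) (meson of_nat_le_iff order_trans real_arch_simple)
    then show ?thesis
    proof eventually_elim
      case (elim n)
      then have "cutoff (real (Suc n)) x = 1 \<and> cutoff_grad (real (Suc n)) x = 0"
        if "x \<in> measure_support (\<mu> s)" for x
        using R0[OF that] by (simp add: cutoff_inside cutoff_grad_inside)
      then show ?case by (simp add: \<psi>_def \<psi>'_def)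
    qed
  qed
  have meas: "f \<in> borel_measurable (\<mu> s)" if "continuous_on UNIV f" "0 \<le> s"
    for s and f :: "'a \<Rightarrow> 'b::topological_space"
    using borel_measurable_continuous_onI[OF that(1)] compact_prob.sets_eq[OF cp[OF that(2)]]
    by (simp cong: measurable_cong_sets)
  have vm: "v s \<in> borel_measurable (\<mu> s)" if "0 \<le> s" for s
    using v[OF that] by auto
  have ev_lhs: "\<forall>\<^sub>F n in sequentially. (\<integral>x. \<psi> n x \<partial>\<mu> s) = (\<integral>x. \<phi> x \<partial>\<mu> s)" if s: "0 \<le> s" for s
    using ev[OF s]
  proof eventually_elim
    case (elim n)
    show ?case
    proof (rule integral_cong_AE)
      show "AE x in \<mu> s. \<psi> n x = \<phi> x"
        using compact_prob.AE_support[OF cp[OF s]] by eventually_elim (use elim in auto)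
      show "\<psi> n \<in> borel_measurable (\<mu> s)"
        unfolding \<psi>_def by (intro meas s continuous_intros cont_\<phi> cont_GDERIV[OF GDERIV_cutoff])
    qed (intro meas s cont_\<phi>)
  qed
  have ev_rhs: "\<forall>\<^sub>F n in sequentially. S n s = F s" if s: "0 \<le> s" for s
    using ev[OF s]
  proof eventually_elim
    case (elim n)
    show ?case
      unfolding S_def F_def
    proof (rule integral_cong_AE)
      show "AE x in \<mu> s. \<psi>' n x \<bullet> v s x = \<phi>' x \<bullet> v s x"
        using compact_prob.AE_support[OF cp[OF s]] by eventually_elim (use elim in auto)
    qed (intro borel_measurable_inner meas s cont_\<psi>' \<phi>(2) vm)+
  qed
  have Sbound: "\<bar>S n s\<bar> \<le> K * (\<integral>x. norm (v s x) \<partial>\<mu> s)" if s: "0 \<le> s" for n s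
  proof -
    have "norm (S n s) \<le> (\<integral>x. norm (\<psi>' n x \<bullet> v s x) \<partial>\<mu> s)"
      unfolding S_def by (rule integral_norm_bound)
    also have "\<dots> \<le> (\<integral>x. K * norm (v s x) \<partial>\<mu> s)"
    proof (rule integral_mono')
      show "integrable (\<mu> s) (\<lambda>x. K * norm (v s x))" using v[OF s] by simp
      fix x
      have "\<bar>\<psi>' n x \<bullet> v s x\<bar> \<le> norm (\<psi>' n x) * norm (v s x)" by (rule Cauchy_Schwarz_ineq2)
      also have "\<dots> \<le> K * norm (v s x)" by (intro mult_right_mono K) simp
      finally show "norm (\<psi>' n x \<bullet> v s x) \<le> K * norm (v s x)" by simp
      show "0 \<le> K * norm (v s x)"
        using order_trans[OF norm_ge_zero K] by simp
    qed
    finally show ?thesis by simp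
  qed
  have lim: "(\<lambda>n. indicator {0..t} s *\<^sub>R S n s) \<longlonglongrightarrow> indicator {0..t} s *\<^sub>R F s" for s
  proof (cases "s \<in> {0..t}")
    case True
    then show ?thesis
      using tendsto_eventually[OF ev_rhs[of s]] by simp
  qed simp
  have limAE: "AE s in lborel. (\<lambda>n. indicator {0..t} s *\<^sub>R S n s) \<longlonglongrightarrow> indicator {0..t} s *\<^sub>R F s"
    by (rule AE_I2) (rule lim)
  have Sm: "(\<lambda>s. indicator {0..t} s *\<^sub>R S n s) \<in> borel_measurable lborel" for n
    using ce'(1)[of n] unfolding set_integrable_def by (rule borel_measurable_integrable)
  \<comment> \<open>Measurability in time of the limiting integrand is not given by the weak
    equation; it is inherited from the truncated ones through the pointwise limit.\<close>
  have Fm: "(\<lambda>s. indicator {0..t} s *\<^sub>R F s) \<in> borel_measurable lborel"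
    by (rule borel_measurable_LIMSEQ_metric[OF Sm lim])
  have dom: "integrable lborel (\<lambda>s. K * (indicator {0..t} s *\<^sub>R (\<integral>x. norm (v s x) \<partial>\<mu> s)))"
    using ce t unfolding continuity_equation_def set_integrable_def
    by (intro integrable_mult_right) blast
  have domb: "AE s in lborel. norm (indicator {0..t} s *\<^sub>R S n s)
      \<le> K * (indicator {0..t} s *\<^sub>R (\<integral>x. norm (v s x) \<partial>\<mu> s))" for n
    using Sbound by (auto intro!: AE_I2 simp: indicator_def)
  show "set_integrable lborel {0..t} (\<lambda>s. \<integral>x. \<phi>' x \<bullet> v s x \<partial>\<mu> s)"
    unfolding set_integrable_def F_def[symmetric]
    by (rule integrable_dominated_convergence[OF Fm Sm dom limAE domb])
  have "(\<lambda>n. LINT s:{0..t}|lborel. S n s) \<longlonglongrightarrow> (LINT s:{0..t}|lborel. F s)"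
    unfolding set_lebesgue_integral_def
    by (rule integral_dominated_convergence[OF Fm Sm dom limAE domb])
  moreover have "\<forall>\<^sub>F n in sequentially.
      (LINT s:{0..t}|lborel. S n s) = (\<integral>x. \<phi> x \<partial>\<mu> t) - (\<integral>x. \<phi> x \<partial>\<mu> 0)"
    using ev_lhs[OF t] ev_lhs[OF order_refl]
  proof eventually_elim
    case (elim n)
    then show ?case using ce'(2)[of n] by simp
  qed
  then have "(\<lambda>n. LINT s:{0..t}|lborel. S n s) \<longlonglongrightarrow> (\<integral>x. \<phi> x \<partial>\<mu> t) - (\<integral>x. \<phi> x \<partial>\<mu> 0)"
    by (rule tendsto_eventually)
  ultimately have "(LINT s:{0..t}|lborel. F s) = (\<integral>x. \<phi> x \<partial>\<mu> t) - (\<integral>x. \<phi> x \<partial>\<mu> 0)"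
    by (rule LIMSEQ_unique)
  then show "(\<integral>x. \<phi> x \<partial>\<mu> t) = (\<integral>x. \<phi> x \<partial>\<mu> 0) + (LINT s:{0..t}|lborel. (\<integral>x. \<phi>' x \<bullet> v s x \<partial>\<mu> s))"
    by (simp add: F_def)
qed

subsection \<open>Interaction field and control at a fixed time\<close>

locale interaction_kernel =
  fixes a :: "real \<Rightarrow> real" and L :: real
  assumes lipschitz: "L-lipschitz_on {0..} a" and nonneg: "a \<in> {0..} \<rightarrow> {0..}"
begin

lemma L_nonneg: "0 \<le> L"
  using lipschitz by (rule lipschitz_on_nonneg)

lemma kernel_nonneg: "0 \<le> s \<Longrightarrow> 0 \<le> a s"
  using nonneg by auto

lemma kernel_le:
  assumes "0 \<le> s" "s \<le> D"
  shows "a s \<le> a 0 + L * D"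
proof -
  have "dist (a s) (a 0) \<le> L * dist s 0"
    using assms by (intro lipschitz_onD[OF lipschitz]) auto
  moreover have "L * s \<le> L * D"
    using assms L_nonneg by (intro mult_left_mono)
  ultimately show ?thesis using assms by (auto simp: dist_real_def)
qed

lemma continuous_kernel: "continuous_on UNIV (\<lambda>z. a (norm z))"
proof -
  have "continuous_on {0..} a"
    using lipschitz by (rule lipschitz_on_continuous_on)
  then show ?thesis
    by (rule continuous_on_compose2) (auto intro: continuous_intros)
qed

lemma continuous_on_kernel [continuous_intros]:
  "continuous_on S f \<Longrightarrow> continuous_on S (\<lambda>x. a (norm (f x)))"
  by (rule continuous_on_compose2[OF continuous_kernel]) auto

end

locale compact_prob_interaction = compact_prob \<mu> + interaction_kernel a L
  for \<mu> :: "'a::euclidean_space measure" and a L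
begin

lemma inner_interaction_field:
  "e \<bullet> interaction_field a \<mu> x = (\<integral>y. a (norm (x - y)) * (e \<bullet> (y - x)) \<partial>\<mu>)"
proof -
  have "integrable \<mu> (\<lambda>y. a (norm (x - y)) *\<^sub>R (y - x))"
    by (intro integrable_continuous continuous_intros)
  then show ?thesis
    unfolding interaction_field_def by (subst integral_inner_right[symmetric]) auto
qed

text \<open>Only the kernel is estimated through the diameter bound \<open>D\<close>; the factor
  e.(y - x) keeps the width in direction \<open>e\<close> itself. This makes the attraction
  comparable with the control direction by direction.\<close>

lemma inner_interaction_field_bound:
  assumes D: "\<And>x y. x \<in> measure_support \<mu> \<Longrightarrow> y \<in> measure_support \<mu> \<Longrightarrow> norm (x - y) \<le> D"
    and x: "x \<in> measure_support \<mu>"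
  shows "\<bar>e \<bullet> interaction_field a \<mu> x\<bar> \<le> (a 0 + L * D) * (extent \<mu> e + extent \<mu> (- e))"
proof -
  have "norm (\<integral>y. a (norm (x - y)) * (e \<bullet> (y - x)) \<partial>\<mu>)
      \<le> (\<integral>y. norm (a (norm (x - y)) * (e \<bullet> (y - x))) \<partial>\<mu>)"
    by (rule integral_norm_bound)
  also have "\<dots> \<le> (\<integral>y. (a 0 + L * D) * (extent \<mu> e + extent \<mu> (- e)) \<partial>\<mu>)"
  proof (rule integral_mono_AE)
    show "AE y in \<mu>. norm (a (norm (x - y)) * (e \<bullet> (y - x)))
        \<le> (a 0 + L * D) * (extent \<mu> e + extent \<mu> (- e))"
      using AE_support
    proof eventually_elim
      case (elim y)
      have "\<bar>e \<bullet> (y - x)\<bar> \<le> extent \<mu> e + extent \<mu> (- e)"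
        using extent_upper[OF elim, of e] extent_lower[OF elim, of e]
          extent_upper[OF x, of e] extent_lower[OF x, of e]
        by (simp add: inner_diff_right abs_le_iff)
      moreover have "\<bar>a (norm (x - y))\<bar> \<le> a 0 + L * D"
        using kernel_le[OF norm_ge_zero D[OF x elim]] kernel_nonneg[of "norm (x - y)"] by simp
      ultimately show ?case
        unfolding real_norm_def abs_mult by (intro mult_mono) auto
    qed
  qed (intro integrable_continuous continuous_intros)+
  finally show ?thesis
    by (simp add: inner_interaction_field prob_space)
qed

lemma support_diameter_bound:
  obtains D where "\<And>x y. x \<in> measure_support \<mu> \<Longrightarrow> y \<in> measure_support \<mu> \<Longrightarrow> norm (x - y) \<le> D"
proof -
  obtain R where R: "\<And>x. x \<in> measure_support \<mu> \<Longrightarrow> norm x \<le> R"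
    using norm_support_bound by blast
  show ?thesis
  proof (rule that)
    fix x y assume "x \<in> measure_support \<mu>" "y \<in> measure_support \<mu>"
    then show "norm (x - y) \<le> R + R"
      by (intro norm_triangle_le_diff add_mono R)
  qed
qed

lemma measurable_pair_continuous:
  fixes f :: "'a \<times> 'a \<Rightarrow> 'b::{second_countable_topology, real_normed_vector}"
  assumes "continuous_on UNIV f"
  shows "f \<in> borel_measurable (\<mu> \<Otimes>\<^sub>M \<mu>)"
  using borel_measurable_continuous_onI[OF assms]
  by (simp add: borel_prod[symmetric] cong: measurable_cong_sets sets_pair_measure_cong[OF sets_eq sets_eq])

lemma measurable_interaction_field: "interaction_field a \<mu> \<in> borel_measurable borel"
proof -
  have "(\<lambda>(x, y). a (norm (x - y)) *\<^sub>R (y - x)) \<in> borel_measurable (borel \<Otimes>\<^sub>M \<mu>)"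
  proof -
    have "continuous_on UNIV (\<lambda>z::'a \<times> 'a. a (norm (fst z - snd z)) *\<^sub>R (snd z - fst z))"
      by (intro continuous_intros)
    then show ?thesis
      using borel_measurable_continuous_onI
      by (fastforce simp: borel_prod[symmetric] case_prod_beta
          cong: measurable_cong_sets sets_pair_measure_cong[OF refl sets_eq])
  qed
  then show ?thesis
    unfolding interaction_field_def[abs_def]
    by (intro borel_measurable_lebesgue_integral) (simp add: case_prod_beta)
qed

lemma integrable_interaction_field: "integrable \<mu> (interaction_field a \<mu>)"
proof -
  obtain D where D: "\<And>x y. x \<in> measure_support \<mu> \<Longrightarrow> y \<in> measure_support \<mu> \<Longrightarrow> norm (x - y) \<le> D"
    using support_diameter_bound by blast
  show ?thesis
  proof (rule integrable_on_support[OF measurable_interaction_field], intro AE_I2 impI)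
    fix x assume x: "x \<in> measure_support \<mu>"
    have "norm (interaction_field a \<mu> x) \<le> (\<Sum>e\<in>Basis. \<bar>interaction_field a \<mu> x \<bullet> e\<bar>)"
      by (rule norm_le_l1)
    also have "\<dots> \<le> (\<Sum>e\<in>Basis. (a 0 + L * D) * (extent \<mu> e + extent \<mu> (- e)))"
      using inner_interaction_field_bound[OF D x] by (intro sum_mono) (simp add: inner_commute)
    finally show "norm (interaction_field a \<mu> x)
        \<le> (\<Sum>e\<in>Basis. (a 0 + L * D) * (extent \<mu> e + extent \<mu> (- e)))" .
  qed
qed

text \<open>Exchanging the roles of x and y turns g(e.x) into (g(e.x) - g(e.y)) / 2, which has the sign of e.(x - y).\<close>

lemma attraction_nonpos:
  assumes g: "continuous_on UNIV g" "mono g"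
  shows "(\<integral>x. g (e \<bullet> x) * (e \<bullet> interaction_field a \<mu> x) \<partial>\<mu>) \<le> 0"
proof -
  interpret P: pair_prob_space \<mu> \<mu> by unfold_locales
  define K where "K = (\<lambda>x y. g (e \<bullet> x) * (a (norm (x - y)) * (e \<bullet> (y - x))))"
  have int: "integrable (\<mu> \<Otimes>\<^sub>M \<mu>) f" if f: "continuous_on UNIV f" for f :: "'a \<times> 'a \<Rightarrow> real"
  proof -
    have "compact (f ` (measure_support \<mu> \<times> measure_support \<mu>))"
      using f by (intro compact_continuous_image compact_Times compact_support)
        (auto intro: continuous_on_subset)
    then obtain C where C: "\<forall>z\<in>measure_support \<mu> \<times> measure_support \<mu>. norm (f z) \<le> C"
      using compact_imp_bounded bounded_iff by (metis (no_types, lifting) image_eqI)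
    show ?thesis
    proof (rule P.integrable_const_bound)
      show "f \<in> borel_measurable (\<mu> \<Otimes>\<^sub>M \<mu>)"
        by (rule measurable_pair_continuous[OF f])
      have "AE z in \<mu> \<Otimes>\<^sub>M \<mu>. z \<in> measure_support \<mu> \<times> measure_support \<mu>"
      proof (rule P.AE_pair_measure)
        have "measure_support \<mu> \<times> measure_support \<mu> \<in> sets (\<mu> \<Otimes>\<^sub>M \<mu>)"
          by (intro pair_measureI) (simp_all add: sets_eq borel_closed[OF closed_measure_support])
        then show "{x \<in> space (\<mu> \<Otimes>\<^sub>M \<mu>). x \<in> measure_support \<mu> \<times> measure_support \<mu>} \<in> sets (\<mu> \<Otimes>\<^sub>M \<mu>)"
          by (simp add: space_pair_measure space_eq)
        show "AE x in \<mu>. AE y in \<mu>. (x, y) \<in> measure_support \<mu> \<times> measure_support \<mu>"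
          using AE_support by eventually_elim (use AE_support in auto)
      qed
      then show "AE z in \<mu> \<Otimes>\<^sub>M \<mu>. norm (f z) \<le> C"
        by eventually_elim (use C in auto)
    qed
  qed
  have gc: "continuous_on S (\<lambda>z. g (f z))" if "continuous_on S f" for S and f :: "'b::topological_space \<Rightarrow> real"
    by (rule continuous_on_compose2[OF g(1) that]) auto
  have K1: "integrable (\<mu> \<Otimes>\<^sub>M \<mu>) (\<lambda>(x, y). K x y)" and K2: "integrable (\<mu> \<Otimes>\<^sub>M \<mu>) (\<lambda>(x, y). K y x)"
    unfolding K_def case_prod_beta by (intro int continuous_intros gc)+
  have I1: "(\<integral>x. \<integral>y. K x y \<partial>\<mu> \<partial>\<mu>) = integral\<^sup>L (\<mu> \<Otimes>\<^sub>M \<mu>) (\<lambda>(x, y). K x y)"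
    using P.integral_fst'[OF K1] by simp
  have I2: "(\<integral>x. \<integral>y. K y x \<partial>\<mu> \<partial>\<mu>) = integral\<^sup>L (\<mu> \<Otimes>\<^sub>M \<mu>) (\<lambda>(x, y). K y x)"
    using P.integral_fst'[OF K2] by simp
  have "(\<integral>y. \<integral>x. K x y \<partial>\<mu> \<partial>\<mu>) = (\<integral>x. \<integral>y. K x y \<partial>\<mu> \<partial>\<mu>)"
    using P.Fubini_integral[OF K1] .
  with I1 I2 have "2 * (\<integral>x. \<integral>y. K x y \<partial>\<mu> \<partial>\<mu>)
      = integral\<^sup>L (\<mu> \<Otimes>\<^sub>M \<mu>) (\<lambda>(x, y). K x y) + integral\<^sup>L (\<mu> \<Otimes>\<^sub>M \<mu>) (\<lambda>(x, y). K y x)"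
    by simp
  also have "\<dots> = (\<integral>z. (case z of (x, y) \<Rightarrow> K x y) + (case z of (x, y) \<Rightarrow> K y x) \<partial>(\<mu> \<Otimes>\<^sub>M \<mu>))"
    by (rule Bochner_Integration.integral_add[OF K1 K2, symmetric])
  also have "\<dots> \<le> (\<integral>z. 0 \<partial>(\<mu> \<Otimes>\<^sub>M \<mu>))"
  proof (rule integral_mono[OF Bochner_Integration.integrable_add[OF K1 K2]])
    show "integrable (\<mu> \<Otimes>\<^sub>M \<mu>) (\<lambda>z. 0 :: real)" by simp
    fix z :: "'a \<times> 'a"
    obtain x y where z: "z = (x, y)" by (cases z)
    have "K x y + K y x = a (norm (x - y)) * ((g (e \<bullet> x) - g (e \<bullet> y)) * (e \<bullet> y - e \<bullet> x))"
      by (simp add: K_def inner_diff_right norm_minus_commute[of y x] algebra_simps)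
    moreover have "(g (e \<bullet> x) - g (e \<bullet> y)) * (e \<bullet> y - e \<bullet> x) \<le> 0"
      using monoD[OF g(2), of "e \<bullet> x" "e \<bullet> y"] monoD[OF g(2), of "e \<bullet> y" "e \<bullet> x"]
      by (cases "e \<bullet> x \<le> e \<bullet> y") (auto intro: mult_nonpos_nonneg mult_nonneg_nonpos)
    ultimately show "(case z of (x, y) \<Rightarrow> K x y) + (case z of (x, y) \<Rightarrow> K y x) \<le> 0"
      using kernel_nonneg[of "norm (x - y)"] z by (simp add: mult_nonneg_nonpos)
  qed
  finally show ?thesis
    by (simp add: inner_interaction_field K_def)
qed

end

section \<open>Maximising control sets for a small support\<close>

context compact_prob
begin

lemma spreading_controlD:
  assumes "spreading_control M c \<mu> \<omega> u"
  shows "(\<lambda>x. indicat_real \<omega> x *\<^sub>R u x) \<in> borel_measurable borel"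
    and "0 < M \<Longrightarrow> AE x in \<mu>. norm (indicat_real \<omega> x *\<^sub>R u x) \<le> M"
proof -
  have "\<omega> \<in> sets borel" "u \<in> borel_measurable borel"
    using assms unfolding spreading_control_def is_arg_max_def control_sets_def control_bounded_by_def
    by auto
  then show "(\<lambda>x. indicat_real \<omega> x *\<^sub>R u x) \<in> borel_measurable borel" by simp
  have "AE x in \<mu>. norm (u x) \<le> M"
    using assms unfolding spreading_control_def control_bounded_by_def by blast
  then show "AE x in \<mu>. norm (indicat_real \<omega> x *\<^sub>R u x) \<le> M" if "0 < M"
    by eventually_elim (use that in \<open>auto simp: indicator_def\<close>)
qed

text \<open>The ball is a competitor that already collects the whole integral of the distance to the
  centre. A maximiser therefore leaves out integral zero, and as the integrand is positive off the
  centre, it misses only a null set there.\<close>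

lemma spreading_control_radial:
  assumes ctrl: "spreading_control M c \<mu> \<omega> u"
    and r: "measure_support \<mu> \<subseteq> ball (center_of_mass \<mu>) r"
      "emeasure lborel (ball (center_of_mass \<mu>) r) \<le> ennreal c"
  shows "AE x in \<mu>. x \<noteq> center_of_mass \<mu> \<longrightarrow> indicat_real \<omega> x *\<^sub>R u x =
    (M / norm (x - center_of_mass \<mu>)) *\<^sub>R (x - center_of_mass \<mu>)"
proof -
  define z where "z = center_of_mass \<mu>"
  define J where "J = (\<lambda>\<omega>. LINT x:\<omega>|\<mu>. norm (x - z))"
  have max: "\<omega> \<in> control_sets c" "\<And>A. A \<in> control_sets c \<Longrightarrow> J A \<le> J \<omega>"
    using ctrl unfolding spreading_control_def is_arg_max_def J_def z_def by (auto simp: not_less)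
  have int: "integrable \<mu> (\<lambda>x. norm (x - z))"
    by (intro integrable_continuous continuous_intros)
  have [measurable]: "(\<lambda>x. norm (x - z)) \<in> borel_measurable \<mu>" "ball z r \<in> sets \<mu>"
    using int by (auto simp: sets_eq)
  have \<omega>: "\<omega> \<in> sets \<mu>"
    using max(1) by (simp add: control_sets_def sets_eq)
  have "(\<integral>x. norm (x - z) \<partial>\<mu>) = J (ball z r)"
    unfolding J_def set_lebesgue_integral_def
  proof (rule integral_cong_AE)
    show "AE x in \<mu>. norm (x - z) = indicat_real (ball z r) x *\<^sub>R norm (x - z)"
      using AE_support by eventually_elim (use r(1) in \<open>auto simp: z_def\<close>)
  qed measurable
  also have "\<dots> \<le> J \<omega>"
    using r(2) by (intro max(2)) (auto simp: control_sets_def z_def)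
  finally have le: "(\<integral>x. norm (x - z) \<partial>\<mu>) \<le> J \<omega>" .
  have intc: "integrable \<mu> (\<lambda>x. indicat_real (- \<omega>) x * norm (x - z))"
  proof -
    have "integrable \<mu> (\<lambda>x. indicat_real (- \<omega>) x *\<^sub>R norm (x - z))"
      using \<omega> sets.compl_sets[OF \<omega>] by (intro integrable_mult_indicator int) (simp add: space_eq Compl_eq_Diff_UNIV)
    then show ?thesis by simp
  qed
  have "(\<integral>x. norm (x - z) \<partial>\<mu>) = (\<integral>x. indicat_real \<omega> x *\<^sub>R norm (x - z) + indicat_real (- \<omega>) x * norm (x - z) \<partial>\<mu>)"
    by (intro Bochner_Integration.integral_cong) (auto simp: indicator_def)
  also have "\<dots> = J \<omega> + (\<integral>x. indicat_real (- \<omega>) x * norm (x - z) \<partial>\<mu>)"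
    unfolding J_def set_lebesgue_integral_def
    by (intro Bochner_Integration.integral_add integrable_mult_indicator \<omega> int intc)
  finally have "(\<integral>x. indicat_real (- \<omega>) x * norm (x - z) \<partial>\<mu>) \<le> 0"
    using le by simp
  then have "(\<integral>x. indicat_real (- \<omega>) x * norm (x - z) \<partial>\<mu>) = 0"
    by (intro antisym Bochner_Integration.integral_nonneg) auto
  then have "AE x in \<mu>. indicat_real (- \<omega>) x * norm (x - z) = 0"
    using integral_nonneg_eq_0_iff_AE[OF intc] by simp
  then show ?thesis
  proof eventually_elim
    case (elim x)
    have "x \<in> \<omega>" if "x \<noteq> z" using elim that by (auto simp: indicator_def split: if_splits)
    then show ?case
      using ctrl unfolding spreading_control_def z_def by (auto simp: indicator_def)
  qed
qed

end

subsection \<open>Evolution of the extents\<close>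

text \<open>The exponential continued beyond \<open>N\<close> by its tangent line. For k \<ge> 0 it
  is C^1 and convex with bounded derivative, hence a Lipschitz test profile, and it agrees with the
  exponential on measures whose extent is at most \<open>N\<close>.\<close>

definition linear_tail_exp :: "real \<Rightarrow> real \<Rightarrow> real \<Rightarrow> real" where
  "linear_tail_exp k N s = (if s \<le> N then exp (k * s) else exp (k * N) * (1 + k * (s - N)))"

lemma DERIV_linear_tail_exp:
  "(linear_tail_exp k N has_real_derivative k * exp (k * min s N)) (at s)"
proof -
  have exp: "((\<lambda>s. exp (k * s)) has_real_derivative k * exp (k * s)) (at s)" for s
    by (auto intro!: derivative_eq_intros)
  have lin: "((\<lambda>s. exp (k * N) * (1 + k * (s - N))) has_real_derivative k * exp (k * N)) (at s)" for s
    by (auto intro!: derivative_eq_intros)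
  consider "s < N" | "s > N" | "s = N" by linarith
  then show ?thesis
  proof cases
    case 1
    with exp[of s] show ?thesis
      by (auto intro: has_field_derivative_transform_within_open[of _ _ _ "{..<N}"]
        simp: linear_tail_exp_def min_def)
  next
    case 2
    with lin[of s] show ?thesis
      by (auto intro: has_field_derivative_transform_within_open[of _ _ _ "{N<..}"]
        simp: linear_tail_exp_def min_def)
  next
    case 3
    have "((\<lambda>y. (linear_tail_exp k N y - linear_tail_exp k N N) / (y - N)) \<longlongrightarrow> k * exp (k * N)) (at N)"
    proof (rule filterlim_split_at)
      have "((\<lambda>y. (exp (k * y) - exp (k * N)) / (y - N)) \<longlongrightarrow> k * exp (k * N)) (at_left N)"
        using exp[of N] unfolding has_field_derivative_iff by (rule filterlim_mono) (auto intro: at_le)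
      then show "((\<lambda>y. (linear_tail_exp k N y - linear_tail_exp k N N) / (y - N)) \<longlongrightarrow> k * exp (k * N)) (at_left N)"
        by (rule Lim_transform_eventually) (auto simp: eventually_at_filter linear_tail_exp_def)
      have "((\<lambda>y. (exp (k * N) * (1 + k * (y - N)) - exp (k * N) * (1 + k * (N - N))) / (y - N))
          \<longlongrightarrow> k * exp (k * N)) (at_right N)"
        using lin[of N] unfolding has_field_derivative_iff by (rule filterlim_mono) (auto intro: at_le)
      then show "((\<lambda>y. (linear_tail_exp k N y - linear_tail_exp k N N) / (y - N)) \<longlongrightarrow> k * exp (k * N)) (at_right N)"
        by (rule Lim_transform_eventually) (auto simp: eventually_at_filter linear_tail_exp_def)
    qed
    then show ?thesis using 3 by (simp add: has_field_derivative_iff)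
  qed
qed

section \<open>Controlled flows and test functions of one linear coordinate\<close>

locale controlled_flow = interaction_kernel a L for a L +
  fixes M c :: real and \<mu> :: "real \<Rightarrow> 'a::euclidean_space measure"
    and \<omega> :: "real \<Rightarrow> 'a set" and u v :: "real \<Rightarrow> 'a \<Rightarrow> 'a"
  defines "v \<equiv> \<lambda>t x. interaction_field a (\<mu> t) x + indicat_real (\<omega> t) x *\<^sub>R u t x"
  assumes M_pos: "0 < M" and c_pos: "0 < c"
    and compact_prob: "0 \<le> t \<Longrightarrow> compact_prob (\<mu> t)"
    and continuity: "continuity_equation \<mu> v"
    and control: "0 \<le> t \<Longrightarrow> spreading_control M c (\<mu> t) (\<omega> t) (u t)"
begin

lemma compact_prob_interaction: "0 \<le> t \<Longrightarrow> compact_prob_interaction (\<mu> t) a L"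
  by (intro compact_prob_interaction.intro compact_prob) unfold_locales

lemma inner_velocity:
  "e \<bullet> v t x = e \<bullet> interaction_field a (\<mu> t) x + e \<bullet> (indicat_real (\<omega> t) x *\<^sub>R u t x)"
  by (simp add: v_def inner_add_right)

lemma measurable_velocity:
  assumes "0 \<le> t"
  shows "v t \<in> borel_measurable borel"
proof -
  interpret compact_prob_interaction "\<mu> t" a L by (rule compact_prob_interaction[OF assms])
  show ?thesis
    unfolding v_def
    by (intro borel_measurable_add measurable_interaction_field spreading_controlD(1)[OF control[OF assms]])
qed

lemma measurable_inner_velocity:
  assumes "0 \<le> t"
  shows "(\<lambda>x. e \<bullet> v t x) \<in> borel_measurable (\<mu> t)"
proof -
  interpret compact_prob "\<mu> t" by (rule compact_prob[OF assms])
  show ?thesis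
    using measurable_velocity[OF assms] by measurable
qed

lemma control_bound:
  assumes "0 \<le> t"
  shows "AE x in \<mu> t. \<bar>e \<bullet> (indicat_real (\<omega> t) x *\<^sub>R u t x)\<bar> \<le> M * norm e"
proof -
  interpret compact_prob "\<mu> t" by (rule compact_prob[OF assms])
  show ?thesis
    using spreading_controlD(2)[OF control[OF assms] M_pos]
  proof eventually_elim
    case (elim x)
    have "\<bar>e \<bullet> (indicat_real (\<omega> t) x *\<^sub>R u t x)\<bar> \<le> norm e * norm (indicat_real (\<omega> t) x *\<^sub>R u t x)"
      by (rule Cauchy_Schwarz_ineq2)
    also have "\<dots> \<le> norm e * M"
      by (intro mult_left_mono elim) simp
    finally show ?case by (simp add: mult.commute)
  qed
qed

lemma integrable_velocity:
  assumes "0 \<le> t"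
  shows "integrable (\<mu> t) (v t)"
proof -
  interpret compact_prob_interaction "\<mu> t" a L by (rule compact_prob_interaction[OF assms])
  have "integrable (\<mu> t) (\<lambda>x. indicat_real (\<omega> t) x *\<^sub>R u t x)"
    using spreading_controlD(2)[OF control[OF assms] M_pos]
    by (intro integrable_on_support[where C = M] spreading_controlD(1)[OF control[OF assms]]) auto
  then show ?thesis
    unfolding v_def by (intro Bochner_Integration.integrable_add integrable_interaction_field)
qed

text \<open>A function of e.x is constant along hyperplanes orthogonal to \<open>e\<close>, so in
  general it has no compact support; this is why the weak equation was extended to Lipschitz test
  functions.\<close>

lemma
  assumes \<psi>: "\<And>s. (\<psi> has_real_derivative \<psi>' s) (at s)" "continuous_on UNIV \<psi>'" "\<And>s. \<bar>\<psi>' s\<bar> \<le> C"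
    and t: "0 \<le> t"
  shows directional_integrable:
      "set_integrable lborel {0..t} (\<lambda>s. \<integral>x. \<psi>' (e \<bullet> x) * (e \<bullet> v s x) \<partial>\<mu> s)"
    and directional_equation:
      "(\<integral>x. \<psi> (e \<bullet> x) \<partial>\<mu> t) = (\<integral>x. \<psi> (e \<bullet> x) \<partial>\<mu> 0)
        + (LINT s:{0..t}|lborel. (\<integral>x. \<psi>' (e \<bullet> x) * (e \<bullet> v s x) \<partial>\<mu> s))"
proof -
  have g: "GDERIV (\<lambda>x. \<psi> (e \<bullet> x)) x :> \<psi>' (e \<bullet> x) *\<^sub>R e" for x
  proof (rule GDERIV_DERIV_compose[OF _ \<psi>(1)])
    show "GDERIV (\<lambda>x. e \<bullet> x) x :> e"
      unfolding gderiv_def by (auto intro!: derivative_eq_intros simp: inner_commute)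
  qed
  have c: "continuous_on UNIV (\<lambda>x. \<psi>' (e \<bullet> x) *\<^sub>R e)"
    by (intro continuous_intros continuous_on_compose2[OF \<psi>(2)]) auto
  have b: "norm (\<psi>' (e \<bullet> x) *\<^sub>R e) \<le> C * norm e" for x
    using \<psi>(3) by (auto intro: mult_right_mono)
  show "set_integrable lborel {0..t} (\<lambda>s. \<integral>x. \<psi>' (e \<bullet> x) * (e \<bullet> v s x) \<partial>\<mu> s)"
    using continuity_equation_lipschitz_integrable[OF continuity compact_prob integrable_velocity g c b t]
    by simp
  show "(\<integral>x. \<psi> (e \<bullet> x) \<partial>\<mu> t) = (\<integral>x. \<psi> (e \<bullet> x) \<partial>\<mu> 0)
        + (LINT s:{0..t}|lborel. (\<integral>x. \<psi>' (e \<bullet> x) * (e \<bullet> v s x) \<partial>\<mu> s))"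
    using continuity_equation_lipschitz[OF continuity compact_prob integrable_velocity g c b t]
    by simp
qed

lemma continuous_linear_tail_exp: "continuous_on S (linear_tail_exp k N)"
  by (rule DERIV_continuous_on[OF DERIV_linear_tail_exp[THEN has_field_derivative_at_within]])

lemma
  assumes "0 \<le> k" "0 \<le> t"
  shows exp_directional_integrable:
      "set_integrable lborel {0..t} (\<lambda>s. \<integral>x. (k * exp (k * min (e \<bullet> x) N)) * (e \<bullet> v s x) \<partial>\<mu> s)"
    and exp_directional_equation:
      "(\<integral>x. linear_tail_exp k N (e \<bullet> x) \<partial>\<mu> t) = (\<integral>x. linear_tail_exp k N (e \<bullet> x) \<partial>\<mu> 0)
        + (LINT s:{0..t}|lborel. (\<integral>x. (k * exp (k * min (e \<bullet> x) N)) * (e \<bullet> v s x) \<partial>\<mu> s))"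
proof -
  have c: "continuous_on UNIV (\<lambda>s. k * exp (k * min s N))" by (intro continuous_intros)
  have b: "\<bar>k * exp (k * min s N)\<bar> \<le> k * exp (k * N)" for s
    using assms by (auto simp: abs_mult intro!: mult_left_mono)
  show "set_integrable lborel {0..t} (\<lambda>s. \<integral>x. (k * exp (k * min (e \<bullet> x) N)) * (e \<bullet> v s x) \<partial>\<mu> s)"
    by (rule directional_integrable[OF DERIV_linear_tail_exp c b assms(2)])
  show "(\<integral>x. linear_tail_exp k N (e \<bullet> x) \<partial>\<mu> t) = (\<integral>x. linear_tail_exp k N (e \<bullet> x) \<partial>\<mu> 0)
        + (LINT s:{0..t}|lborel. (\<integral>x. (k * exp (k * min (e \<bullet> x) N)) * (e \<bullet> v s x) \<partial>\<mu> s))"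
    by (rule directional_equation[OF DERIV_linear_tail_exp c b assms(2)])
qed

lemma linear_tail_exp_integral:
  assumes "0 \<le> t" "extent (\<mu> t) e \<le> N"
  shows "(\<integral>x. linear_tail_exp k N (e \<bullet> x) \<partial>\<mu> t) = (\<integral>x. exp (k * (e \<bullet> x)) \<partial>\<mu> t)"
proof -
  interpret compact_prob "\<mu> t" by (rule compact_prob[OF assms(1)])
  show ?thesis
  proof (rule integral_cong_AE)
    show "AE x in \<mu> t. linear_tail_exp k N (e \<bullet> x) = exp (k * (e \<bullet> x))"
      using AE_extent[of e] by eventually_elim (use assms(2) in \<open>auto simp: linear_tail_exp_def\<close>)
    show "(\<lambda>x. linear_tail_exp k N (e \<bullet> x)) \<in> borel_measurable (\<mu> t)"
      by (intro borel_measurable_integrable integrable_continuous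
          continuous_on_compose2[OF continuous_linear_tail_exp] continuous_intros) auto
  qed measurable
qed

section \<open>Exponential moments and finite speed of the support\<close>

lemma log_laplace_extent:
  assumes "0 \<le> t"
  shows "(\<lambda>n. ln (\<integral>x. exp (real n * (e \<bullet> x)) \<partial>\<mu> t) / real n) \<longlonglongrightarrow> extent (\<mu> t) e"
proof -
  interpret compact_prob "\<mu> t" by (rule compact_prob[OF assms])
  obtain R where R: "\<And>x. x \<in> measure_support (\<mu> t) \<Longrightarrow> norm x \<le> R"
    using norm_support_bound by blast
  show ?thesis
  proof (rule log_laplace_tendsto[where B = "norm e * R"])
    show "AE x in \<mu> t. \<bar>e \<bullet> x\<bar> \<le> norm e * R"
      using AE_support
    proof eventually_elim
      case (elim x)
      have "\<bar>e \<bullet> x\<bar> \<le> norm e * norm x" by (rule Cauchy_Schwarz_ineq2)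
      also have "\<dots> \<le> norm e * R" by (intro mult_left_mono R elim) simp
      finally show ?case .
    qed
  qed (use prob_above AE_extent in \<open>auto simp: space_eq\<close>)
qed

lemma laplace_pos:
  assumes "0 \<le> t"
  shows "0 < (\<integral>x. exp (k * (e \<bullet> x)) \<partial>\<mu> t)"
proof -
  interpret compact_prob "\<mu> t" by (rule compact_prob[OF assms])
  have i: "integrable (\<mu> t) (\<lambda>x. exp (k * (e \<bullet> x)))"
    by (intro integrable_continuous continuous_intros)
  have "(\<integral>x. exp (k * (e \<bullet> x)) \<partial>\<mu> t) \<noteq> 0"
  proof
    assume "(\<integral>x. exp (k * (e \<bullet> x)) \<partial>\<mu> t) = 0"
    then have "AE x in \<mu> t. exp (k * (e \<bullet> x)) = 0"
      using integral_nonneg_eq_0_iff_AE[OF i] by simp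
    then show False by simp
  qed
  moreover have "0 \<le> (\<integral>x. exp (k * (e \<bullet> x)) \<partial>\<mu> t)" by simp
  ultimately show ?thesis by linarith
qed

text \<open>The attraction contributes a nonpositive term by symmetry and the control at most n M
  |e| times the test integral. Gronwall bounds the exponential moment by a factor exp(n M |e| t),
  and (1/n) ln turns this into a speed bound M |e|.\<close>

lemma extent_growth:
  assumes t: "0 \<le> t"
  shows "extent (\<mu> t) e \<le> extent (\<mu> 0) e + M * norm e * t"
proof -
  \<comment> \<open>Only the supports at times 0 and t lie below \<open>N\<close>, so the test
    integral is a true exponential moment at these two times. Intermediate supports may reach
    beyond, where the tangent tail applies.\<close>
  define N where "N = max (extent (\<mu> 0) e) (extent (\<mu> t) e)"
  define Z where "Z = (\<lambda>n s. \<integral>x. exp (real n * (e \<bullet> x)) \<partial>\<mu> s)"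
  have Z_le: "Z n t \<le> Z n 0 * exp (real n * (M * norm e) * t)" for n
  proof -
    define F where "F = (\<lambda>s. \<integral>x. linear_tail_exp n N (e \<bullet> x) \<partial>\<mu> s)"
    define g where "g = (\<lambda>s. real n * exp (real n * min s N))"
    have gc: "continuous_on UNIV g" unfolding g_def by (intro continuous_intros)
    \<comment> \<open>Monotonicity of the derivative, i.e. convexity of the profile, is what
      \<open>attraction_nonpos\<close> asks for.\<close>
    have gm: "mono g"
      unfolding g_def by (intro monoI mult_left_mono) (auto intro: mult_left_mono min.mono)
    have "F t \<le> F 0 * exp (real n * (M * norm e) * t)"
    proof (rule gronwall_integral[where F = F and T = t and K = "real n * (M * norm e)"])
      show "set_integrable lborel {0..t}
          (\<lambda>s. \<integral>x. (real n * exp (real n * min (e \<bullet> x) N)) * (e \<bullet> v s x) \<partial>\<mu> s)"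
        using t by (intro exp_directional_integrable) auto
      show "0 \<le> real n * (M * norm e)" using M_pos by simp
      show "F s = F 0 + (LINT s:{0..s}|lborel. (\<integral>x. (real n * exp (real n * min (e \<bullet> x) N)) * (e \<bullet> v s x) \<partial>\<mu> s))"
        if "s \<in> {0..t}" for s
        unfolding F_def using that by (intro exp_directional_equation) auto
      fix s assume "s \<in> {0..t}"
      then have s: "0 \<le> s" by simp
      interpret compact_prob_interaction "\<mu> s" a L by (rule compact_prob_interaction[OF s])
      have gci: "continuous_on UNIV (\<lambda>x. g (e \<bullet> x))"
        by (intro continuous_on_compose2[OF gc] continuous_intros) auto
      have gmeas: "(\<lambda>x. g (e \<bullet> x)) \<in> borel_measurable borel"
        using gci by (rule borel_measurable_continuous_onI)
      have gb: "\<bar>g y\<bar> \<le> real n * exp (real n * N)" for y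
        by (auto simp: g_def abs_mult intro!: mult_left_mono)
      have i: "integrable (\<mu> s) (\<lambda>x. g (e \<bullet> x) * f x)"
        if "integrable (\<mu> s) f" for f :: "'a \<Rightarrow> real"
      proof (rule Bochner_Integration.integrable_bound)
        show "integrable (\<mu> s) (\<lambda>x. real n * exp (real n * N) * f x)" using that by simp
        show "(\<lambda>x. g (e \<bullet> x) * f x) \<in> borel_measurable (\<mu> s)"
          using borel_measurable_integrable[OF that] gmeas
          by (intro borel_measurable_times) (simp_all cong: measurable_cong_sets add: sets_eq)
        show "AE x in \<mu> s. norm (g (e \<bullet> x) * f x) \<le> norm (real n * exp (real n * N) * f x)"
          using gb by (intro AE_I2) (auto simp: abs_mult intro!: mult_right_mono)
      qed
      have i1: "integrable (\<mu> s) (\<lambda>x. e \<bullet> interaction_field a (\<mu> s) x)"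
        using integrable_interaction_field by simp
      have i2: "integrable (\<mu> s) (\<lambda>x. e \<bullet> (indicat_real (\<omega> s) x *\<^sub>R u s x))"
        using spreading_controlD(1)[OF control[OF s]] control_bound[OF s, of e]
        by (intro integrable_on_support[where C = "M * norm e"] borel_measurable_inner) auto
      have "(\<integral>x. g (e \<bullet> x) * (e \<bullet> v s x) \<partial>\<mu> s) = (\<integral>x. g (e \<bullet> x) * (e \<bullet> interaction_field a (\<mu> s) x) \<partial>\<mu> s)
          + (\<integral>x. g (e \<bullet> x) * (e \<bullet> (indicat_real (\<omega> s) x *\<^sub>R u s x)) \<partial>\<mu> s)"
        unfolding inner_velocity distrib_left
        by (intro Bochner_Integration.integral_add i i1 i2)
      also have "\<dots> \<le> (\<integral>x. g (e \<bullet> x) * (e \<bullet> (indicat_real (\<omega> s) x *\<^sub>R u s x)) \<partial>\<mu> s)"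
        using attraction_nonpos[OF gc gm] by simp
      also have "\<dots> \<le> (\<integral>x. real n * (M * norm e) * linear_tail_exp n N (e \<bullet> x) \<partial>\<mu> s)"
      proof (rule integral_mono_AE[OF i[OF i2]])
        show "integrable (\<mu> s) (\<lambda>x. real n * (M * norm e) * linear_tail_exp n N (e \<bullet> x))"
          by (intro integrable_mult_right integrable_continuous
            continuous_on_compose2[OF continuous_linear_tail_exp] continuous_intros) auto
        show "AE x in \<mu> s. g (e \<bullet> x) * (e \<bullet> (indicat_real (\<omega> s) x *\<^sub>R u s x))
            \<le> real n * (M * norm e) * linear_tail_exp n N (e \<bullet> x)"
          using control_bound[OF s, of e]
        proof eventually_elim
          case (elim x)
          have "g (e \<bullet> x) * (e \<bullet> (indicat_real (\<omega> s) x *\<^sub>R u s x)) \<le> g (e \<bullet> x) * (M * norm e)"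
            using elim by (intro mult_left_mono) (auto simp: g_def)
          \<comment> \<open>Beyond \<open>N\<close> the derivative stays at n exp(n N), and the
            tangent line lies above exp(n N).\<close>
          also have "\<dots> \<le> (real n * linear_tail_exp n N (e \<bullet> x)) * (M * norm e)"
            using M_pos unfolding g_def
            by (intro mult_right_mono mult_left_mono)
              (auto simp: linear_tail_exp_def min_def mult_le_cancel_left1)
          finally show ?case by (simp add: mult_ac)
        qed
      qed
      finally show "(\<integral>x. (real n * exp (real n * min (e \<bullet> x) N)) * (e \<bullet> v s x) \<partial>\<mu> s)
          \<le> real n * (M * norm e) * F s"
        by (simp add: F_def g_def)
    qed (use t in auto)
    then show ?thesis
      using t by (simp add: F_def Z_def linear_tail_exp_integral N_def)
  qed
  have "(\<lambda>n. ln (Z n 0) / real n + M * norm e * t) \<longlonglongrightarrow> extent (\<mu> 0) e + M * norm e * t"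
    unfolding Z_def by (intro tendsto_add tendsto_const log_laplace_extent) simp
  moreover have "(\<lambda>n. ln (Z n t) / real n) \<longlonglongrightarrow> extent (\<mu> t) e"
    unfolding Z_def by (rule log_laplace_extent[OF t])
  moreover have "\<forall>\<^sub>F n in sequentially. ln (Z n t) / real n \<le> ln (Z n 0) / real n + M * norm e * t"
    using eventually_gt_at_top[of 0]
  proof eventually_elim
    case (elim n)
    have pos: "Z n t > 0" "Z n 0 > 0"
      unfolding Z_def using laplace_pos t by auto
    then have "ln (Z n t) \<le> ln (Z n 0 * exp (real n * (M * norm e) * t))"
      using Z_le[of n] by simp
    also have "\<dots> = ln (Z n 0) + real n * (M * norm e * t)"
      using pos by (simp add: ln_mult)
    finally show ?case
      using elim by (simp add: field_simps)
  qed
  ultimately show ?thesis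
    by (intro tendsto_le[OF sequentially_bot])
qed

text \<open>Finite speed turns compactness at each single time into a bound uniform on [0, T], on
  which all later domination arguments rest.\<close>

lemma support_bounded_on:
  assumes "0 \<le> T"
  obtains R where "\<And>s x. s \<in> {0..T} \<Longrightarrow> x \<in> measure_support (\<mu> s) \<Longrightarrow> norm x \<le> R"
proof (rule that)
  fix s x assume s: "s \<in> {0..T}" and x: "x \<in> measure_support (\<mu> s)"
  interpret compact_prob "\<mu> s" using s by (intro compact_prob) simp
  have "norm x \<le> (\<Sum>e\<in>Basis. \<bar>x \<bullet> e\<bar>)" by (rule norm_le_l1)
  also have "\<dots> \<le> (\<Sum>e\<in>Basis. \<bar>extent (\<mu> 0) e\<bar> + \<bar>extent (\<mu> 0) (- e)\<bar> + M * norm e * T)"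
  proof (rule sum_mono)
    fix e :: 'a
    have "M * norm e * s \<le> M * norm e * T"
      using s M_pos by (intro mult_left_mono) auto
    then have "e \<bullet> x \<le> extent (\<mu> 0) e + M * norm e * T" "- (e \<bullet> x) \<le> extent (\<mu> 0) (- e) + M * norm e * T"
      using extent_upper[OF x, of e] extent_lower[OF x, of e] extent_growth[of s e] extent_growth[of s "- e"] s
      by auto
    then show "\<bar>x \<bullet> e\<bar> \<le> \<bar>extent (\<mu> 0) e\<bar> + \<bar>extent (\<mu> 0) (- e)\<bar> + M * norm e * T"
      by (auto simp: inner_commute abs_le_iff)
  qed
  finally show "norm x \<le> (\<Sum>e\<in>Basis. \<bar>extent (\<mu> 0) e\<bar> + \<bar>extent (\<mu> 0) (- e)\<bar> + M * norm e * T)" .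
qed

lemma velocity_bounded_on:
  assumes "0 \<le> T"
  obtains C where "\<And>s. s \<in> {0..T} \<Longrightarrow> AE x in \<mu> s. \<bar>e \<bullet> v s x\<bar> \<le> C"
proof -
  obtain R where R: "\<And>s x. s \<in> {0..T} \<Longrightarrow> x \<in> measure_support (\<mu> s) \<Longrightarrow> norm x \<le> R"
    using support_bounded_on[OF assms] by blast
  show ?thesis
  proof (rule that)
    fix s assume s: "s \<in> {0..T}"
    then have s0: "0 \<le> s" by simp
    interpret compact_prob_interaction "\<mu> s" a L by (rule compact_prob_interaction[OF s0])
    have D: "norm (x - y) \<le> R + R" if "x \<in> measure_support (\<mu> s)" "y \<in> measure_support (\<mu> s)" for x y
      by (intro norm_triangle_le_diff add_mono R[OF s] that)
    have R0: "0 \<le> R" using support_nonempty R[OF s] norm_ge_zero order_trans by blast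
    have ext: "extent (\<mu> s) d \<le> norm d * R" for d
    proof (rule extent_least)
      fix x assume "x \<in> measure_support (\<mu> s)"
      then have "norm d * norm x \<le> norm d * R"
        by (rule mult_left_mono[OF R[OF s] norm_ge_zero])
      then show "d \<bullet> x \<le> norm d * R" using norm_cauchy_schwarz[of d x] by linarith
    qed
    have A: "0 \<le> a 0 + L * (R + R)"
      using kernel_nonneg[of 0] L_nonneg R0 by simp
    show "AE x in \<mu> s. \<bar>e \<bullet> v s x\<bar> \<le> (a 0 + L * (R + R)) * (2 * norm e * R) + M * norm e"
      using control_bound[OF s0, of e] AE_support
    proof eventually_elim
      case (elim x)
      have "\<bar>e \<bullet> interaction_field a (\<mu> s) x\<bar> \<le> (a 0 + L * (R + R)) * (extent (\<mu> s) e + extent (\<mu> s) (- e))"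
        by (rule inner_interaction_field_bound[OF D elim(2)])
      also have "\<dots> \<le> (a 0 + L * (R + R)) * (2 * norm e * R)"
        using ext[of e] ext[of "- e"] by (intro mult_left_mono A) simp
      finally show ?case
        using elim(1) unfolding inner_velocity by linarith
    qed
  qed
qed

section \<open>Tilted averages as growth rates of the extents\<close>

definition tilted_velocity :: "'a \<Rightarrow> nat \<Rightarrow> real \<Rightarrow> real" where
  "tilted_velocity e n s =
    (\<integral>x. exp (real n * (e \<bullet> x)) * (e \<bullet> v s x) \<partial>\<mu> s) / (\<integral>x. exp (real n * (e \<bullet> x)) \<partial>\<mu> s)"

lemma tilted_velocity_bound:
  assumes s: "0 \<le> s" and C: "AE x in \<mu> s. \<bar>e \<bullet> v s x\<bar> \<le> C"
  shows "\<bar>\<integral>x. exp (real n * (e \<bullet> x)) * (e \<bullet> v s x) \<partial>\<mu> s\<bar> \<le> C * (\<integral>x. exp (real n * (e \<bullet> x)) \<partial>\<mu> s)"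
    and "\<bar>tilted_velocity e n s\<bar> \<le> C"
proof -
  interpret compact_prob "\<mu> s" by (rule compact_prob[OF s])
  have i: "integrable (\<mu> s) (\<lambda>x. exp (real n * (e \<bullet> x)))"
    by (intro integrable_continuous continuous_intros)
  have "norm (\<integral>x. exp (real n * (e \<bullet> x)) * (e \<bullet> v s x) \<partial>\<mu> s)
      \<le> (\<integral>x. norm (exp (real n * (e \<bullet> x)) * (e \<bullet> v s x)) \<partial>\<mu> s)"
    by (rule integral_norm_bound)
  also have "\<dots> \<le> (\<integral>x. C * exp (real n * (e \<bullet> x)) \<partial>\<mu> s)"
  proof (rule integral_mono_AE')
    show "integrable (\<mu> s) (\<lambda>x. C * exp (real n * (e \<bullet> x)))" using i by simp
    show "AE x in \<mu> s. norm (exp (real n * (e \<bullet> x)) * (e \<bullet> v s x)) \<le> C * exp (real n * (e \<bullet> x))"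
      using C by eventually_elim (simp add: abs_mult mult.commute)
    show "AE x in \<mu> s. 0 \<le> C * exp (real n * (e \<bullet> x))"
      using C by eventually_elim auto
  qed
  finally show *: "\<bar>\<integral>x. exp (real n * (e \<bullet> x)) * (e \<bullet> v s x) \<partial>\<mu> s\<bar>
      \<le> C * (\<integral>x. exp (real n * (e \<bullet> x)) \<partial>\<mu> s)" by simp
  show "\<bar>tilted_velocity e n s\<bar> \<le> C"
    using * laplace_pos[OF s, of "real n" e] by (simp add: tilted_velocity_def divide_simps)
qed

text \<open>With the uniform support bound, \<open>N\<close> exceeds |e.x| on all supports up to
  time T, so the tangent tail is never reached and the moments lie between exp(-n N) and exp(n N).
  These are the bounds that \<open>ln_of_integral\<close> needs; the factor n from differentiating
  the exponential cancels against 1 / n.\<close>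

lemma log_laplace_evolution:
  assumes n: "0 < n" and T: "0 \<le> T"
  shows "set_integrable lborel {0..T} (tilted_velocity e n)"
    and "t \<in> {0..T} \<Longrightarrow> ln (\<integral>x. exp (real n * (e \<bullet> x)) \<partial>\<mu> t) / real n - ln (\<integral>x. exp (real n * (e \<bullet> x)) \<partial>\<mu> 0) / real n
      = (LINT s:{0..t}|lborel. tilted_velocity e n s)"
proof -
  obtain R where R: "\<And>s x. s \<in> {0..T} \<Longrightarrow> x \<in> measure_support (\<mu> s) \<Longrightarrow> norm x \<le> R"
    using support_bounded_on[OF T] by blast
  obtain C where C: "\<And>s. s \<in> {0..T} \<Longrightarrow> AE x in \<mu> s. \<bar>e \<bullet> v s x\<bar> \<le> C"
    using velocity_bounded_on[OF T] by blast
  define N where "N = norm e * R"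
  define F where "F = (\<lambda>s. \<integral>x. exp (real n * (e \<bullet> x)) \<partial>\<mu> s)"
  define z where "z = (\<lambda>s. \<integral>x. (real n * exp (real n * min (e \<bullet> x) N)) * (e \<bullet> v s x) \<partial>\<mu> s)"
  have ex: "\<bar>e \<bullet> x\<bar> \<le> N" if "s \<in> {0..T}" "x \<in> measure_support (\<mu> s)" for s x
  proof -
    have "norm e * norm x \<le> norm e * R" by (rule mult_left_mono[OF R[OF that] norm_ge_zero])
    then show ?thesis unfolding N_def using Cauchy_Schwarz_ineq2[of e x] by linarith
  qed
  have extN: "extent (\<mu> s) e \<le> N" if s: "s \<in> {0..T}" for s
  proof -
    interpret compact_prob "\<mu> s" using s by (intro compact_prob) simp
    show ?thesis by (rule extent_least) (use ex[OF s] in \<open>force simp: abs_le_iff\<close>)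
  qed
  have z_eq: "z s = real n * (\<integral>x. exp (real n * (e \<bullet> x)) * (e \<bullet> v s x) \<partial>\<mu> s)" if s: "s \<in> {0..T}" for s
  proof -
    have s0: "0 \<le> s" using s by simp
    interpret compact_prob "\<mu> s" by (rule compact_prob[OF s0])
    note [measurable] = measurable_inner_velocity[OF s0]
    have "z s = (\<integral>x. real n * (exp (real n * (e \<bullet> x)) * (e \<bullet> v s x)) \<partial>\<mu> s)"
      unfolding z_def
    proof (rule integral_cong_AE)
      show "AE x in \<mu> s. real n * exp (real n * min (e \<bullet> x) N) * (e \<bullet> v s x)
          = real n * (exp (real n * (e \<bullet> x)) * (e \<bullet> v s x))"
        using AE_support by eventually_elim (use ex[OF s] in \<open>force simp: abs_le_iff min_def\<close>)
    qed measurable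
    then show ?thesis by simp
  qed
  have F_bounds: "exp (- (real n * N)) \<le> F s" "F s \<le> exp (real n * N)" if s: "s \<in> {0..T}" for s
  proof -
    have s0: "0 \<le> s" using s by simp
    interpret compact_prob "\<mu> s" by (rule compact_prob[OF s0])
    have i: "integrable (\<mu> s) (\<lambda>x. exp (real n * (e \<bullet> x)))"
      by (intro integrable_continuous continuous_intros)
    have b: "AE x in \<mu> s. - (real n * N) \<le> real n * (e \<bullet> x) \<and> real n * (e \<bullet> x) \<le> real n * N"
      using AE_support
    proof eventually_elim
      case (elim x)
      have "real n * - N \<le> real n * (e \<bullet> x)" "real n * (e \<bullet> x) \<le> real n * N"
        using ex[OF s elim] by (intro mult_left_mono; simp add: abs_le_iff)+
      then show ?case by simp
    qed
    have "(\<integral>x. exp (- (real n * N)) \<partial>\<mu> s) \<le> F s"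
      unfolding F_def using b by (intro integral_mono_AE i) auto
    moreover have "F s \<le> (\<integral>x. exp (real n * N) \<partial>\<mu> s)"
      unfolding F_def using b by (intro integral_mono_AE i) auto
    ultimately show "exp (- (real n * N)) \<le> F s" "F s \<le> exp (real n * N)"
      by (simp_all add: prob_space)
  qed
  have zi: "set_integrable lborel {0..T} z"
    unfolding z_def using T by (intro exp_directional_integrable) auto
  have zb: "\<bar>z s\<bar> \<le> real n * (\<bar>C\<bar> * exp (real n * N))" if s: "s \<in> {0..T}" for s
  proof -
    have "\<bar>z s\<bar> \<le> real n * (C * F s)"
      unfolding z_eq[OF s] abs_mult F_def
      using tilted_velocity_bound(1)[OF _ C[OF s], of n] s by (auto intro!: mult_left_mono)
    also have "C * F s \<le> \<bar>C\<bar> * exp (real n * N)"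
      using F_bounds[OF s] laplace_pos[of s "real n" e] s
      by (intro mult_mono) (auto simp: F_def)
    finally show ?thesis by (simp add: mult_left_mono)
  qed
  have Fz: "F t = F 0 + (LINT s:{0..t}|lborel. z s)" if t: "t \<in> {0..T}" for t
    using exp_directional_equation[of "real n" t N e] linear_tail_exp_integral[OF _ extN[OF t], of n]
      linear_tail_exp_integral[OF _ extN, of 0 n] t T
    by (simp add: F_def z_def)
  note * = ln_of_integral[OF zi zb Fz exp_gt_zero F_bounds(1)]
  have q: "z s / F s = real n * tilted_velocity e n s" if "s \<in> {0..T}" for s
    using z_eq[OF that] by (simp add: tilted_velocity_def F_def)
  have "set_integrable lborel {0..T} (\<lambda>s. (z s / F s) / real n)"
    using *(1) by (intro set_integrable_divide) auto
  then show "set_integrable lborel {0..T} (tilted_velocity e n)"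
    by (rule set_integrable_cong[THEN iffD1, rotated 3]) (use q n in auto)
  show "ln (\<integral>x. exp (real n * (e \<bullet> x)) \<partial>\<mu> t) / real n - ln (\<integral>x. exp (real n * (e \<bullet> x)) \<partial>\<mu> 0) / real n
      = (LINT s:{0..t}|lborel. tilted_velocity e n s)" if t: "t \<in> {0..T}"
  proof -
    have "ln (F t) - ln (F 0) = (LINT s:{0..t}|lborel. z s / F s)"
      using *(2) t by blast
    also have "\<dots> = (LINT s:{0..t}|lborel. real n * tilted_velocity e n s)"
      using q t by (intro set_lebesgue_integral_cong) auto
    finally show ?thesis
      using n by (simp add: F_def field_simps)
  qed
qed

lemma log_laplace_increment:
  assumes "0 < n" "0 \<le> s" "s \<le> t"
  shows "ln (\<integral>x. exp (real n * (e \<bullet> x)) \<partial>\<mu> t) / real n - ln (\<integral>x. exp (real n * (e \<bullet> x)) \<partial>\<mu> s) / real n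
      = (LINT r:{s<..t}|lborel. tilted_velocity e n r)"
proof -
  have "0 \<le> t" using assms by simp
  note ev = log_laplace_evolution[OF assms(1) this, where e = e]
  show ?thesis
    using ev(2)[of t] ev(2)[of s] assms set_integral_diff_atLeastAtMost[OF ev(1) assms(2,3) order_refl]
    by simp
qed

text \<open>An average of e.v obeys the bound of e.v, whatever the tilt. The Lipschitz constant of
  the log-moments is thus independent of n and survives the limit.\<close>

lemma extent_lipschitz_on:
  assumes "0 \<le> T"
  obtains C where "C-lipschitz_on {0..T} (\<lambda>t. extent (\<mu> t) e)"
proof -
  obtain C where C: "\<And>s. s \<in> {0..T} \<Longrightarrow> AE x in \<mu> s. \<bar>e \<bullet> v s x\<bar> \<le> C"
    using velocity_bounded_on[OF assms] by blast
  have C0: "0 \<le> C"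
    using tilted_velocity_bound(2)[OF _ C, of 0 0] assms by (meson abs_ge_zero atLeastAtMost_iff order_refl order_trans)
  have le: "\<bar>extent (\<mu> t) e - extent (\<mu> s) e\<bar> \<le> C * (t - s)" if st: "0 \<le> s" "s \<le> t" "t \<le> T" for s t
  proof -
    define G where "G = (\<lambda>t n. ln (\<integral>x. exp (real n * (e \<bullet> x)) \<partial>\<mu> t) / real n)"
    have "(\<lambda>n. \<bar>G t n - G s n\<bar>) \<longlonglongrightarrow> \<bar>extent (\<mu> t) e - extent (\<mu> s) e\<bar>"
      unfolding G_def using st by (intro tendsto_intros log_laplace_extent) auto
    moreover have "\<forall>\<^sub>F n in sequentially. \<bar>G t n - G s n\<bar> \<le> C * (t - s)"
      using eventually_gt_at_top[of 0]
    proof eventually_elim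
      case (elim n)
      have "\<bar>LINT r:{s<..t}|lborel. tilted_velocity e n r\<bar> \<le> C * (t - s)"
      proof (rule set_integral_abs_le)
        show "set_integrable lborel {s<..t} (tilted_velocity e n)"
          using st by (intro set_integrable_subset[OF log_laplace_evolution(1)[OF elim assms]]) auto
        show "\<bar>tilted_velocity e n r\<bar> \<le> C" if "s < r" "r \<le> t" for r
          using that st by (intro tilted_velocity_bound(2) C) auto
      qed (use st in simp)
      then show ?case
        using log_laplace_increment[OF elim st(1,2), of e] by (simp add: G_def)
    qed
    ultimately show ?thesis
      by (intro tendsto_upperbound[OF _ _ sequentially_bot])
  qed
  have "C-lipschitz_on {0..T} (\<lambda>t. extent (\<mu> t) e)"
  proof (rule lipschitz_onI)
    fix s t assume "s \<in> {0..T}" "t \<in> {0..T}"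
    then show "dist (extent (\<mu> s) e) (extent (\<mu> t) e) \<le> C * dist s t"
      using le[of s t] le[of t s] by (cases "s \<le> t") (auto simp: dist_real_def abs_minus_commute)
  qed (rule C0)
  then show ?thesis by (rule that)
qed

section \<open>Growth of the width while the support is small\<close>

text \<open>Under a strong tilt only points with e.x close to the extent count. There e.(x - m) is
  positive, so replacing the distance to the centre m by the larger radius \<open>r\<close> lowers
  the control term, and the attraction costs at most the kernel bound at distance 2r times the
  width.\<close>

lemma tilted_velocity_ge:
  assumes s: "0 \<le> s" and e: "norm e = 1"
    and r: "measure_support (\<mu> s) \<subseteq> ball (center_of_mass (\<mu> s)) r"
      "emeasure lborel (ball (center_of_mass (\<mu> s)) r) \<le> ennreal c"
    and w: "0 < extent (\<mu> s) e + extent (\<mu> s) (- e)" and "0 < \<epsilon>"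
  shows "\<forall>\<^sub>F n in sequentially. M / r * (extent (\<mu> s) e - e \<bullet> center_of_mass (\<mu> s))
      - (a 0 + L * (2 * r)) * (extent (\<mu> s) e + extent (\<mu> s) (- e)) - \<epsilon> \<le> tilted_velocity e n s"
proof -
  interpret compact_prob_interaction "\<mu> s" a L by (rule compact_prob_interaction[OF s])
  define z where "z = center_of_mass (\<mu> s)"
  define h where "h = extent (\<mu> s) e"
  define A where "A = (a 0 + L * (2 * r)) * (extent (\<mu> s) e + extent (\<mu> s) (- e))"
  have r0: "0 < r" using r(1) support_nonempty by (metis ball_empty not_le subset_empty)
  have mh: "e \<bullet> z < h" unfolding z_def h_def by (rule center_less_extent[OF w])
  \<comment> \<open>The first entry keeps \<open>k\<close> above the level of the centre, so that
    points beyond it differ from the centre and are pushed outwards; the second limits the loss M /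
    r (h - k) to \<epsilon> / 2. The other half of \<epsilon> is spent on the tilting error.\<close>
  define k where "k = max ((e \<bullet> z + h) / 2) (h - \<epsilon> * r / (2 * M))"
  have k: "e \<bullet> z < k" "k < h"
    using mh M_pos r0 \<open>0 < \<epsilon>\<close> by (auto simp: k_def less_max_iff_disj)
  have near: "norm (x - z) < r" if "x \<in> measure_support (\<mu> s)" for x
    using r(1) that by (auto simp: z_def dist_norm norm_minus_commute)
  have D: "norm (x - y) \<le> 2 * r" if "x \<in> measure_support (\<mu> s)" "y \<in> measure_support (\<mu> s)" for x y
    using norm_triangle_ineq4[of "x - z" "y - z"] near[OF that(1)] near[OF that(2)] by simp
  obtain R where R: "\<And>x. x \<in> measure_support (\<mu> s) \<Longrightarrow> norm x \<le> R"
    using norm_support_bound by blast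
  obtain C where C: "\<And>t. t \<in> {0..s} \<Longrightarrow> AE x in \<mu> t. \<bar>e \<bullet> v t x\<bar> \<le> C"
    using velocity_bounded_on[OF s] by blast
  have "\<forall>\<^sub>F n in sequentially. (M / r * (k - e \<bullet> z) - A) - \<epsilon> / 2 \<le> tilted_velocity e n s"
    unfolding tilted_velocity_def
  proof (rule tilted_average_ge[where B = R and C = C and k = k and k' = "(k + h) / 2"])
    show "(\<lambda>x. e \<bullet> v s x) \<in> borel_measurable (\<mu> s)" by (rule measurable_inner_velocity[OF s])
    show "AE x in \<mu> s. \<bar>e \<bullet> x\<bar> \<le> R"
      using AE_support
    proof eventually_elim
      case (elim x)
      then show ?case using R[OF elim] Cauchy_Schwarz_ineq2[of e x] e by simp
    qed
    show "AE x in \<mu> s. \<bar>e \<bullet> v s x\<bar> \<le> C" using C[of s] s by simp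
    show "0 < prob {x \<in> space (\<mu> s). (k + h) / 2 < e \<bullet> x}"
      using prob_above[of "(k + h) / 2" e] k by (simp add: space_eq h_def)
    show "AE x in \<mu> s. k < e \<bullet> x \<longrightarrow> M / r * (k - e \<bullet> z) - A \<le> e \<bullet> v s x"
      using spreading_control_radial[OF control[OF s] r] AE_support
    proof eventually_elim
      case (elim x)
      show ?case
      proof
        assume kx: "k < e \<bullet> x"
        then have "x \<noteq> z" using k by auto
        then have "e \<bullet> (indicat_real (\<omega> s) x *\<^sub>R u s x) = M / norm (x - z) * (e \<bullet> x - e \<bullet> z)"
          using elim(1) by (simp add: z_def inner_diff_right)
        moreover have "M / r * (k - e \<bullet> z) \<le> M / norm (x - z) * (e \<bullet> x - e \<bullet> z)"
          using kx k M_pos r0 near[OF elim(2)] \<open>x \<noteq> z\<close>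
          by (intro mult_mono divide_left_mono mult_pos_pos) auto
        moreover have "\<bar>e \<bullet> interaction_field a (\<mu> s) x\<bar> \<le> A"
          unfolding A_def by (rule inner_interaction_field_bound[OF D elim(2)])
        ultimately show "M / r * (k - e \<bullet> z) - A \<le> e \<bullet> v s x"
          unfolding inner_velocity by linarith
      qed
    qed
  qed (use k \<open>0 < \<epsilon>\<close> in auto)
  moreover have "M / r * (h - e \<bullet> z) - A - \<epsilon> \<le> (M / r * (k - e \<bullet> z) - A) - \<epsilon> / 2"
  proof -
    have "h - k \<le> \<epsilon> * r / (2 * M)" by (simp add: k_def)
    then have "M / r * (h - k) \<le> M / r * (\<epsilon> * r / (2 * M))"
      using M_pos r0 by (intro mult_left_mono) auto
    also have "\<dots> = \<epsilon> / 2" using M_pos r0 by simp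
    finally show ?thesis unfolding right_diff_distrib by linarith
  qed
  ultimately show ?thesis
    unfolding z_def h_def A_def by (auto elim: eventually_mono)
qed

text \<open>The motion of the centre of mass cancels between the two opposite directions.\<close>

lemma tilted_velocity_sum_ge:
  assumes s: "0 \<le> s" and e: "norm e = 1"
    and r: "measure_support (\<mu> s) \<subseteq> ball (center_of_mass (\<mu> s)) r"
      "emeasure lborel (ball (center_of_mass (\<mu> s)) r) \<le> ennreal c"
      "2 * (a 0 + L * (2 * r)) + 1 \<le> M / r"
    and "0 < \<epsilon>"
  shows "\<forall>\<^sub>F n in sequentially. extent (\<mu> s) e + extent (\<mu> s) (- e) - \<epsilon>
      \<le> tilted_velocity e n s + tilted_velocity (- e) n s"
proof -
  interpret compact_prob_interaction "\<mu> s" a L by (rule compact_prob_interaction[OF s])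
  define w where "w = extent (\<mu> s) e + extent (\<mu> s) (- e)"
  have w0: "0 \<le> w" using center_le_extent[of e] center_ge_extent[of e] by (simp add: w_def)
  show ?thesis
  proof (cases "w = 0")
    \<comment> \<open>In a flat direction the centre lies on the extremal hyperplane and the strict
      inequality is lost. But then e.x is constant almost everywhere, the tilts have no effect, and
      the two opposite averages add up to zero.\<close>
    case True
    define h where "h = extent (\<mu> s) e"
    have h: "AE x in \<mu> s. e \<bullet> x = h"
      using AE_support
    proof eventually_elim
      case (elim x)
      show ?case using extent_upper[OF elim, of e] extent_lower[OF elim, of e] True by (simp add: w_def h_def)
    qed
    note [measurable] = measurable_inner_velocity[OF s]
    have *: "tilted_velocity d n s = (\<integral>x. d \<bullet> v s x \<partial>\<mu> s)"
      if d: "AE x in \<mu> s. d \<bullet> x = h'" for d h' n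
    proof -
      have "(\<integral>x. exp (real n * (d \<bullet> x)) * (d \<bullet> v s x) \<partial>\<mu> s) = (\<integral>x. exp (real n * h') * (d \<bullet> v s x) \<partial>\<mu> s)"
        by (rule integral_cong_AE) (use d in auto)
      moreover have "(\<integral>x. exp (real n * (d \<bullet> x)) \<partial>\<mu> s) = (\<integral>x. exp (real n * h') \<partial>\<mu> s)"
        by (rule integral_cong_AE) (use d in auto)
      ultimately show ?thesis by (simp add: tilted_velocity_def prob_space)
    qed
    have "tilted_velocity e n s + tilted_velocity (- e) n s = 0" for n
      using *[of e h n] *[of "- e" "- h" n] h by simp
    then show ?thesis
      using True \<open>0 < \<epsilon>\<close> by (simp add: w_def)
  next
    case False
    with w0 have w: "0 < w" by simp
    let ?A = "a 0 + L * (2 * r)" and ?z = "center_of_mass (\<mu> s)"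
    have "\<forall>\<^sub>F n in sequentially. M / r * (extent (\<mu> s) e - e \<bullet> ?z) - ?A * w - \<epsilon> / 2 \<le> tilted_velocity e n s"
      unfolding w_def using w \<open>0 < \<epsilon>\<close> by (intro tilted_velocity_ge s e r) (auto simp: w_def)
    moreover have "\<forall>\<^sub>F n in sequentially. M / r * (extent (\<mu> s) (- e) - (- e) \<bullet> ?z) - ?A * w - \<epsilon> / 2
        \<le> tilted_velocity (- e) n s"
      using tilted_velocity_ge[OF s _ r(1,2), of "- e" "\<epsilon> / 2"] w \<open>0 < \<epsilon>\<close> e
      by (simp add: w_def add.commute)
    ultimately show ?thesis
    proof eventually_elim
      case (elim n)
      \<comment> \<open>The choice of \<open>r\<close> makes M / r exceed twice the kernel bound by
        at least 1, so the net rate is at least the width.\<close>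
      have "w \<le> (M / r - 2 * ?A) * w"
        using r(3) w by (simp add: mult_le_cancel_right1)
      also have "\<dots> = M / r * (extent (\<mu> s) e - e \<bullet> ?z) + M / r * (extent (\<mu> s) (- e) - (- e) \<bullet> ?z) - 2 * (?A * w)"
        by (simp add: w_def algebra_simps)
      finally show ?case using elim unfolding w_def by linarith
    qed
  qed
qed

text \<open>With a constant lower bound \<open>b\<close> for the width, the inequality w' \<ge> w is
  only needed as linear growth: b = 0 yields monotonicity, the initial width actual growth. The left
  endpoint is excluded from the hypotheses because the lemma is also started at a time when the
  total width may still be at the threshold.\<close>

lemma width_growth:
  assumes st: "0 \<le> s" "s \<le> t" and e: "norm e = 1"
    and r: "\<And>q. s < q \<Longrightarrow> q \<le> t \<Longrightarrow> measure_support (\<mu> q) \<subseteq> ball (center_of_mass (\<mu> q)) r"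
      "\<And>z::'a. emeasure lborel (ball z r) \<le> ennreal c"
      "2 * (a 0 + L * (2 * r)) + 1 \<le> M / r"
    and b: "\<And>q. s < q \<Longrightarrow> q \<le> t \<Longrightarrow> b \<le> extent (\<mu> q) e + extent (\<mu> q) (- e)"
  shows "b * (t - s) \<le> (extent (\<mu> t) e + extent (\<mu> t) (- e)) - (extent (\<mu> s) e + extent (\<mu> s) (- e))"
proof -
  have t: "0 \<le> t" using st by simp
  define G where "G = (\<lambda>e t n. ln (\<integral>x. exp (real n * (e \<bullet> x)) \<partial>\<mu> t) / real n)"
  define Q where "Q = (\<lambda>n q. tilted_velocity e n q + tilted_velocity (- e) n q)"
  obtain C1 where C1: "\<And>q. q \<in> {0..t} \<Longrightarrow> AE x in \<mu> q. \<bar>e \<bullet> v q x\<bar> \<le> C1"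
    using velocity_bounded_on[OF t] by blast
  obtain C2 where C2: "\<And>q. q \<in> {0..t} \<Longrightarrow> AE x in \<mu> q. \<bar>(- e) \<bullet> v q x\<bar> \<le> C2"
    using velocity_bounded_on[OF t] by blast
  have Qb: "\<bar>Q n q\<bar> \<le> C1 + C2" if "q \<in> {0..t}" for n q
  proof -
    have "0 \<le> q" using that by simp
    then show ?thesis
      using tilted_velocity_bound(2)[OF _ C1[OF that], of n] tilted_velocity_bound(2)[OF _ C2[OF that], of n]
      unfolding Q_def by linarith
  qed
  \<comment> \<open>Indices are shifted to \<open>Suc n\<close> since the log-moments are divided by
    the index.\<close>
  have Qi: "set_integrable lborel {s<..t} (Q (Suc n))" for n
    unfolding Q_def using st
    by (intro set_integral_add set_integrable_subset[OF log_laplace_evolution(1)[OF _ t]]) auto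
  have Qe: "\<forall>\<^sub>F n in sequentially. b - \<epsilon> \<le> Q (Suc n) q" if "s < q" "q \<le> t" "0 < \<epsilon>" for q \<epsilon>
  proof -
    have "\<forall>\<^sub>F n in sequentially. extent (\<mu> q) e + extent (\<mu> q) (- e) - \<epsilon> \<le> Q n q"
      unfolding Q_def using that st by (intro tilted_velocity_sum_ge[OF _ e r]) auto
    then have "\<forall>\<^sub>F n in sequentially. extent (\<mu> q) e + extent (\<mu> q) (- e) - \<epsilon> \<le> Q (Suc n) q"
      by (rule eventually_sequentially_Suc[THEN iffD2])
    then show ?thesis
      by (rule eventually_mono) (use b[OF that(1,2)] in linarith)
  qed
  have c: "set_integrable lborel {s<..t} (\<lambda>q. k)" for k :: real
    unfolding set_integrable_def using st by simp
  \<comment> \<open>For large n only a lower bound on \<open>Q\<close> is known, at each time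
    separately and without a limit. Capping at \<open>b\<close> turns it into convergence under a
    uniform bound, and the capped integral remains below that of \<open>Q\<close>.\<close>
  have lim: "(\<lambda>n. indicator {s<..t} q *\<^sub>R min (Q (Suc n) q) b) \<longlonglongrightarrow> indicator {s<..t} q *\<^sub>R b" for q
  proof (cases "q \<in> {s<..t}")
    case True
    have "(\<lambda>n. min (Q (Suc n) q) b) \<longlonglongrightarrow> b"
    proof (rule LIMSEQ_I)
      fix \<epsilon> :: real assume \<epsilon>: "0 < \<epsilon>"
      then have "\<forall>\<^sub>F n in sequentially. b - \<epsilon> / 2 \<le> Q (Suc n) q"
        using True by (intro Qe) auto
      then have "\<forall>\<^sub>F n in sequentially. norm (min (Q (Suc n) q) b - b) < \<epsilon>"
        by eventually_elim (use \<epsilon> in auto)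
      then show "\<exists>no. \<forall>n\<ge>no. norm (min (Q (Suc n) q) b - b) < \<epsilon>"
        by (simp add: eventually_sequentially)
    qed
    then show ?thesis using True by simp
  qed simp
  have minm: "(\<lambda>q. indicator {s<..t} q *\<^sub>R min (Q (Suc n) q) b) \<in> borel_measurable lborel" for n
  proof -
    have "(\<lambda>q. min (indicator {s<..t} q *\<^sub>R Q (Suc n) q) (indicator {s<..t} q *\<^sub>R b)) \<in> borel_measurable lborel"
      using Qi[of n] c[of b] unfolding set_integrable_def
      by (intro borel_measurable_min borel_measurable_integrable)
    moreover have "min (indicator {s<..t} q *\<^sub>R Q (Suc n) q) (indicator {s<..t} q *\<^sub>R b)
        = indicator {s<..t} q *\<^sub>R min (Q (Suc n) q) b" for q
      by (simp add: indicator_def)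
    ultimately show ?thesis by simp
  qed
  have minb: "AE q in lborel. norm (indicator {s<..t} q *\<^sub>R min (Q (Suc n) q) b)
      \<le> indicator {s<..t} q *\<^sub>R (C1 + C2 + \<bar>b\<bar>)" for n
  proof (rule AE_I2)
    fix q
    show "norm (indicator {s<..t} q *\<^sub>R min (Q (Suc n) q) b) \<le> indicator {s<..t} q *\<^sub>R (C1 + C2 + \<bar>b\<bar>)"
    proof (cases "q \<in> {s<..t}")
      case True
      then have "\<bar>Q (Suc n) q\<bar> \<le> C1 + C2" using st by (intro Qb) auto
      then have "\<bar>min (Q (Suc n) q) b\<bar> \<le> C1 + C2 + \<bar>b\<bar>" unfolding min_def by (auto split: if_split)
      then show ?thesis using True by simp
    qed simp
  qed
  have ci: "integrable lborel (\<lambda>q. indicator {s<..t} q *\<^sub>R k)" for k :: real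
    using c[of k] by (simp add: set_integrable_def)
  have limAE: "AE q in lborel. (\<lambda>n. indicator {s<..t} q *\<^sub>R min (Q (Suc n) q) b) \<longlonglongrightarrow> indicator {s<..t} q *\<^sub>R b"
    by (rule AE_I2) (rule lim)
  have bm: "(\<lambda>q. indicator {s<..t} q *\<^sub>R b) \<in> borel_measurable lborel"
    using ci by (rule borel_measurable_integrable)
  have mini: "set_integrable lborel {s<..t} (\<lambda>q. min (Q (Suc n) q) b)" for n
    unfolding set_integrable_def by (rule integrable_dominated_convergence2[OF bm minm ci limAE minb])
  have "(\<lambda>n. LINT q:{s<..t}|lborel. min (Q (Suc n) q) b) \<longlonglongrightarrow> (LINT q:{s<..t}|lborel. b)"
    unfolding set_lebesgue_integral_def
    by (rule integral_dominated_convergence[OF bm minm ci limAE minb])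
  then have l1: "(\<lambda>n. LINT q:{s<..t}|lborel. min (Q (Suc n) q) b) \<longlonglongrightarrow> b * (t - s)"
    using st by (simp add: set_integral_const mult.commute)
  have l2: "(\<lambda>n. (G e t (Suc n) - G e s (Suc n)) + (G (- e) t (Suc n) - G (- e) s (Suc n)))
      \<longlonglongrightarrow> (extent (\<mu> t) e - extent (\<mu> s) e) + (extent (\<mu> t) (- e) - extent (\<mu> s) (- e))"
    unfolding G_def by (intro tendsto_intros LIMSEQ_Suc[OF log_laplace_extent] st t)
  have "(LINT q:{s<..t}|lborel. min (Q (Suc n) q) b)
      \<le> (G e t (Suc n) - G e s (Suc n)) + (G (- e) t (Suc n) - G (- e) s (Suc n))" for n
  proof -
    have "(LINT q:{s<..t}|lborel. min (Q (Suc n) q) b) \<le> (LINT q:{s<..t}|lborel. Q (Suc n) q)"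
      by (intro set_integral_mono mini Qi) auto
    also have "\<dots> = (LINT q:{s<..t}|lborel. tilted_velocity e (Suc n) q)
        + (LINT q:{s<..t}|lborel. tilted_velocity (- e) (Suc n) q)"
      unfolding Q_def using st
      by (intro set_integral_add set_integrable_subset[OF log_laplace_evolution(1)[OF _ t]]) auto
    finally show ?thesis
      using st log_laplace_increment[of "Suc n" s t e] log_laplace_increment[of "Suc n" s t "- e"]
      by (simp add: G_def)
  qed
  then have "b * (t - s) \<le> (extent (\<mu> t) e - extent (\<mu> s) e) + (extent (\<mu> t) (- e) - extent (\<mu> s) (- e))"
    by (intro LIMSEQ_le[OF l1 l2]) auto
  then show ?thesis by simp
qed

section \<open>Reaching the threshold and staying above it\<close>

lemma support_size_bounded_below:
  assumes "\<nexists>x. \<mu> 0 = return borel x"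
  shows "\<exists>\<eta>>0. \<exists>\<tau>>0. \<forall>t\<ge>\<tau>. support_size (\<mu> t) \<ge> \<eta>"
proof -
  define W where "W = (\<lambda>t. \<Sum>e\<in>Basis. extent (\<mu> t) e + extent (\<mu> t) (- e))"
  define B where "B = unit_ball_vol (real DIM('a))"
  \<comment> \<open>As r \<le> 1, the volume B r^d is at most B r, and r \<le> c / B makes it at
    most \<open>c\<close>. Also by r \<le> 1 the kernel bound at distance 2r is at most a(0) + 2L,
    so the third entry makes M / r at least twice that bound plus 1.\<close>
  define r where "r = min 1 (min (c / B) (M / (2 * (a 0 + L * 2) + 1)))"
  have B: "0 < B" by (simp add: B_def)
  have A: "0 \<le> a 0" "0 \<le> L" using kernel_nonneg[of 0] L_nonneg by auto
  have r: "0 < r" "r \<le> 1" "r \<le> c / B" "r \<le> M / (2 * (a 0 + L * 2) + 1)"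
    using B A M_pos c_pos by (auto simp: r_def add_nonneg_pos)
  have vol: "emeasure lborel (ball z r) \<le> ennreal c" for z :: 'a
  proof -
    have "r ^ DIM('a) \<le> r ^ 1"
      using r by (intro power_decreasing) auto
    then have "B * r ^ DIM('a) \<le> B * (c / B)"
      using r B by (intro mult_left_mono) auto
    then have "B * r ^ DIM('a) \<le> c" using B by simp
    then have "ennreal (B * r ^ DIM('a)) \<le> ennreal c" by (rule ennreal_leI)
    then show ?thesis
      using r emeasure_ball[of r z] by (simp add: B_def)
  qed
  have rate: "2 * (a 0 + L * (2 * r)) + 1 \<le> M / r"
  proof -
    have "r * (2 * (a 0 + L * 2) + 1) \<le> M"
      using r A by (simp add: le_divide_eq add_nonneg_pos)
    moreover have "L * r \<le> L * 1" using r A by (intro mult_left_mono) auto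
    then have "2 * (a 0 + L * (2 * r)) + 1 \<le> 2 * (a 0 + L * 2) + 1" by simp
    then have "r * (2 * (a 0 + L * (2 * r)) + 1) \<le> r * (2 * (a 0 + L * 2) + 1)"
      using r by (intro mult_left_mono) auto
    ultimately have "r * (2 * (a 0 + L * (2 * r)) + 1) \<le> M" by (rule order_trans[rotated])
    then show ?thesis
      unfolding pos_le_divide_eq[OF r(1)] by (subst mult.commute)
  qed
  have small: "measure_support (\<mu> q) \<subseteq> ball (center_of_mass (\<mu> q)) r" if "0 \<le> q" "W q < r" for q
  proof
    interpret compact_prob "\<mu> q" by (rule compact_prob[OF that(1)])
    fix x assume "x \<in> measure_support (\<mu> q)"
    then have "norm (x - center_of_mass (\<mu> q)) \<le> W q"
      by (intro norm_diff_center_le) (simp add: W_def)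
    then show "x \<in> ball (center_of_mass (\<mu> q)) r"
      using that(2) by (simp add: dist_norm norm_minus_commute)
  qed
  have growth: "b * (t - s) \<le> (extent (\<mu> t) e + extent (\<mu> t) (- e)) - (extent (\<mu> s) e + extent (\<mu> s) (- e))"
    if "0 \<le> s" "s \<le> t" "\<And>q. s < q \<Longrightarrow> q \<le> t \<Longrightarrow> W q < r" "e \<in> Basis"
      "\<And>q. s < q \<Longrightarrow> q \<le> t \<Longrightarrow> b \<le> extent (\<mu> q) e + extent (\<mu> q) (- e)" for s t e b
    using that by (intro width_growth[OF _ _ _ _ vol rate] small) (auto intro: order_trans)
  have width_nonneg: "0 \<le> extent (\<mu> t) e + extent (\<mu> t) (- e)" if "0 \<le> t" for t e
  proof -
    interpret compact_prob "\<mu> t" by (rule compact_prob[OF that])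
    show ?thesis using center_le_extent[of e] center_ge_extent[of e] by simp
  qed
  have width_mono: "extent (\<mu> s) e + extent (\<mu> s) (- e) \<le> extent (\<mu> t) e + extent (\<mu> t) (- e)"
    if "0 \<le> s" "s \<le> t" "\<And>q. s < q \<Longrightarrow> q \<le> t \<Longrightarrow> W q < r" "e \<in> Basis" for s t e
    using growth[OF that(1-4), of 0] width_nonneg that(1) by fastforce
  have W_mono: "W s \<le> W t" if "0 \<le> s" "s \<le> t" "\<And>q. s < q \<Longrightarrow> q \<le> t \<Longrightarrow> W q < r" for s t
    unfolding W_def using that by (intro sum_mono width_mono) auto
  have W_pos: "0 < W 0"
  proof -
    interpret compact_prob "\<mu> 0" by (rule compact_prob) simp
    show ?thesis unfolding W_def by (rule width_pos[OF assms])
  qed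
  have W_cont: "continuous_on {0..T} W" if "0 \<le> T" for T
  proof -
    have "continuous_on {0..T} (\<lambda>t. extent (\<mu> t) e)" for e
      using extent_lipschitz_on[OF that, of e] lipschitz_on_continuous_on by blast
    then show ?thesis
      unfolding W_def by (intro continuous_on_sum continuous_on_add)
  qed
  have "\<exists>\<tau>>0. r \<le> W \<tau>"
  proof (rule ccontr)
    assume "\<not> ?thesis"
    then have lt: "W q < r" if "0 < q" for q using that by (auto simp: not_le)
    \<comment> \<open>Below the threshold no width drops under its initial value, so each grows at
      least at that constant rate. After time r / W(0) the total width would be at least W(0) + r,
      contradicting W < r.\<close>
    define t where "t = r / W 0"
    have t: "0 < t" using r W_pos by (simp add: t_def)
    have "W 0 * t \<le> W t - W 0"
    proof -
      have "(\<Sum>e\<in>Basis. (extent (\<mu> 0) e + extent (\<mu> 0) (- e)) * (t - 0)) \<le>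
          (\<Sum>e\<in>Basis. (extent (\<mu> t) e + extent (\<mu> t) (- e)) - (extent (\<mu> 0) e + extent (\<mu> 0) (- e)))"
        using t lt by (intro sum_mono growth width_mono) auto
      then show ?thesis by (simp add: W_def sum_distrib_right sum_subtractf)
    qed
    then show False using W_pos lt[OF t] by (simp add: t_def)
  qed
  then obtain \<tau> where \<tau>: "0 < \<tau>" "r \<le> W \<tau>" by blast
  have W_ge: "r \<le> W t" if t: "\<tau> \<le> t" for t
  proof (rule ccontr)
    assume "\<not> r \<le> W t"
    \<comment> \<open>By continuity there is a last time s up to t with W(s) \<ge> r. From then on W
      stays below r, hence does not decrease, which forces W(t) \<ge> W(s) \<ge> r.\<close>
    define S where "S = {q \<in> {\<tau>..t}. r \<le> W q}"
    have c: "continuous_on {\<tau>..t} W"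
      using W_cont[of t] t \<tau>(1) by (auto intro: continuous_on_subset)
    have "S = {\<tau>..t} \<inter> W -` {r..}" by (auto simp: S_def)
    then have "closed S" "bounded S"
      by (auto intro: continuous_closed_preimage[OF c] bounded_subset[of "{\<tau>..t}"])
    then have "compact S" by (simp add: compact_eq_bounded_closed)
    moreover have "S \<noteq> {}" using \<tau> t by (auto simp: S_def)
    ultimately have "\<exists>s\<in>S. \<forall>q\<in>S. q \<le> s" by (rule compact_attains_sup)
    then obtain s where s: "s \<in> S" "\<And>q. q \<in> S \<Longrightarrow> q \<le> s" by blast
    have "W s \<le> W t"
    proof (rule W_mono)
      fix q assume "s < q" "q \<le> t"
      then have "q \<notin> S" using s(2)[of q] by auto
      then show "W q < r" using \<open>s < q\<close> \<open>q \<le> t\<close> s(1) by (auto simp: S_def)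
    qed (use s(1) \<tau>(1) in \<open>auto simp: S_def\<close>)
    then show False using s(1) \<open>\<not> r \<le> W t\<close> by (simp add: S_def)
  qed
  have "r / (2 * DIM('a)) \<le> support_size (\<mu> t)" if "\<tau> \<le> t" for t
  proof -
    interpret compact_prob "\<mu> t" using that \<tau>(1) by (intro compact_prob) simp
    have "W t \<le> 2 * DIM('a) * support_size (\<mu> t)"
      unfolding W_def by (rule width_le_support_size)
    then have "r \<le> 2 * DIM('a) * support_size (\<mu> t)" using W_ge[OF that] by linarith
    then show ?thesis by (simp add: field_simps)
  qed
  moreover have "0 < r / (2 * DIM('a))" using r by simp
  ultimately show ?thesis using \<tau>(1) by blast
qed

end

theorem theorem2p6:
  fixes M c :: real
    and a :: "real \<Rightarrow> real"
    and \<mu> :: "real \<Rightarrow> 'a::euclidean_space measure"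
    and \<omega> :: "real \<Rightarrow> 'a set"
    and u :: "real \<Rightarrow> 'a \<Rightarrow> 'a"
  assumes "M > 0" and "c > 0"
    and "\<exists>L. L-lipschitz_on {0..} a" and "a \<in> {0..} \<rightarrow> {0..}"
    and "\<forall>t\<ge>0. compactly_supported_prob (\<mu> t)"
    and "\<nexists>x. \<mu> 0 = return borel x"
    and "continuity_equation \<mu>
           (\<lambda>t x. interaction_field a (\<mu> t) x + indicat_real (\<omega> t) x *\<^sub>R u t x)"
    and "\<forall>t\<ge>0. spreading_control M c (\<mu> t) (\<omega> t) (u t)"
  shows "((\<lambda>s. s * a s) \<longlongrightarrow> 0) (at_right 0) \<and>
         (\<exists>\<eta>>0. \<exists>\<tau>>0. \<forall>t\<ge>\<tau>. support_size (\<mu> t) \<ge> \<eta>)"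
proof
  obtain L where L: "L-lipschitz_on {0..} a" using assms(3) by blast
  have "((\<lambda>s. s * a s) \<longlongrightarrow> 0 * a 0) (at 0 within {0..})"
    using lipschitz_on_continuous_on[OF L]
    by (intro tendsto_mult tendsto_ident_at) (auto simp: continuous_on)
  then show "((\<lambda>s. s * a s) \<longlongrightarrow> 0) (at_right 0)"
    by (auto intro: tendsto_within_subset)
  have compact: "compact_prob (\<mu> t)" if "0 \<le> t" for t
    using assms(5) that by (simp add: compact_prob_iff)
  have control: "spreading_control M c (\<mu> t) (\<omega> t) (u t)" if "0 \<le> t" for t
    using assms(8) that by simp
  interpret controlled_flow a L M c \<mu> \<omega> u
    "\<lambda>t x. interaction_field a (\<mu> t) x + indicat_real (\<omega> t) x *\<^sub>R u t x"
    by (intro controlled_flow.intro controlled_flow_axioms.intro interaction_kernel.intro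
        L assms compact control)
  show "\<exists>\<eta>>0. \<exists>\<tau>>0. \<forall>t\<ge>\<tau>. support_size (\<mu> t) \<ge> \<eta>"
    by (rule support_size_bounded_below[OF assms(6)])
qed

end
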